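(* Let $X$ be a topologically complete space and let $\mathcal A$ be a cofinal subfamily of the family of all closed, locally finite, normal covers of $X$. For $\lambda\in\Lambda$ equip $F^{(0)}_\lambda=N^{(0)}_\lambda$ with the relation $r_\lambda$ given by $(u,v)\in r_\lambda$ iff $\wedge u\cap\wedge v\neq\emptyset$. Then the inverse system $\mathbf F^{(0)}=(F^{(0)}_\lambda,\pi^\mu_\lambda;\Lambda)$ of graphs is a complete cell structure, and there exists a unique homeomorphism $h:X\to F^{(0)}_\infty/\!\sim$ such that $h\circ(\pi|_{F^{(0)}_\infty})=\pi_{\mathbf F^{(0)}}$, where $\pi_{\mathbf F^{(0)}}:F^{(0)}_\infty\to F^{(0)}_\infty/\!\sim$ is the quotient map.
   Context: A topologically complete space is a Tychonoff space complete with respect to its finest uniformity. A closed, locally finite, normal cover $\alpha$ of $X$ is a locally finite cover by closed sets admitting a partition of unity $\{\phi_{\alpha,V}:V\in\alpha\}$ with $\mathrm{cl}(\phi_{\alpha,V}^{-1}((0,1]))\subset\mathrm{int}(V)$, $\sum_V\phi_{\alpha,V}=1$. $\mathcal A$ is cofinal if every such cover is refined by some member of $\mathcal A$. Construction: $\Lambda$ is the set of finite subsets of $\mathcal A$ directed by inclusion. For $\lambda\in\Lambda$, $N^{(0)}_\lambda$ is the set of functions $v$ on $\lambda$ with $v(\alpha)\in\alpha$ for all $\alpha\in\lambda$ and $\wedge v:=\bigcap_{\alpha\in\lambda}v(\alpha)\neq\emptyset$ (empty intersection meaning $X$). For $\lambda\subset\mu$, $\pi^\mu_\lambda:N^{(0)}_\mu\to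 N^{(0)}_\lambda$ is restriction $v\mapsto v|_\lambda$. $F^{(0)}_\infty=\varprojlim(N^{(0)}_\lambda,\pi^\mu_\lambda;\Lambda)$ (discrete sets, product topology), $z(\lambda)$ the $\lambda$-coordinate. For $z\in F^{(0)}_\infty$ the set $\bigcap_\lambda\wedge z(\lambda)$ is a single point, denoted $\pi(z)$; this defines $\pi|_{F^{(0)}_\infty}:F^{(0)}_\infty\to X$. Graphs and cell structures: a graph $(G,r)$ is a discrete set with a reflexive symmetric relation; $a,b$ are adjacent if $(a,b)\in r$; $\mathrm{star}_r(A)=\{b:(a,b)\in r\text{ for some }a\in A\}$, $\mathrm{star}_r(a)=\mathrm{star}_r(\{a\})$, $\mathrm{star}^2_r(a)=\mathrm{star}_r(\mathrm{star}_r(a))$. A cell structure is an inverse system $\mathbf G=(G_\lambda,\pi^\mu_\lambda;\Lambda)$ of graphs and relation-preserving bonding maps, with limit $G_\infty$ and $z(\lambda)=\pi_\lambda(z)$, such that for each $z\in G_\infty$ and $\lambda\in\Lambda$: (a) there is $\mu\geq\lambda$ with $\pi^\mu_\lambda(\mathrm{star}^2_{r_\mu}(z(\mu)))\subset\mathrm{star}_{r_\lambda}(z(\lambda))$; (b) there is $\mu\geq\lambda$ with $\pi^\mu_\lambda(\mathrm{star}_{r_\mu}(z(\mu)))$ finite. Threads $z,z'\in G_\infty$ are equivalent, $z\sim z'$, if $z(\lambda),z'(\lambda)$ are adjacent for all $\lambda$; $G_\infty/\!\sim$ carries the quotient topology. A net $y$ on $\Lambda$ with $y(\lambda)\in G_\lambda$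 is Cauchy if there is $\lambda$ such that for every $\lambda^0$ and all $\lambda^1,\lambda^2\geq\lambda,\lambda^0$, the elements $\pi^{\lambda^1}_{\lambda^0}(y(\lambda^1))$ and $\pi^{\lambda^2}_{\lambda^0}(y(\lambda^2))$ are adjacent; it converges to a thread $z$ if there is $\lambda$ with $y(\mu)$ adjacent to $z(\mu)$ for all $\mu\geq\lambda$. A cell structure is complete if every Cauchy net converges to a thread. *)

theory Defs
  imports "HOL-Analysis.Analysis"
begin

definition uniformity_on :: "'a set \<Rightarrow> ('a \<times> 'a) set set \<Rightarrow> bool" where
  "uniformity_on S \<U> \<longleftrightarrow>
     \<U> \<noteq> {} \<and>
     (\<forall>U\<in>\<U>. Id_on S \<subseteq> U \<and> U \<subseteq> S \<times> S) \<and>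
     (\<forall>U\<in>\<U>. \<forall>V. U \<subseteq> V \<and> V \<subseteq> S \<times> S \<longrightarrow> V \<in> \<U>) \<and>
     (\<forall>U\<in>\<U>. \<forall>V\<in>\<U>. U \<inter> V \<in> \<U>) \<and>
     (\<forall>U\<in>\<U>. converse U \<in> \<U>) \<and>
     (\<forall>U\<in>\<U>. \<exists>V\<in>\<U>. V O V \<subseteq> U)"

definition compatible_uniformity :: "'a topology \<Rightarrow> ('a \<times> 'a) set set \<Rightarrow> bool" where
  "compatible_uniformity X \<U> \<longleftrightarrow>
     uniformity_on (topspace X) \<U> \<and>
     (\<forall>W. openin X W \<longleftrightarrow> W \<subseteq> topspace X \<and> (\<forall>x\<in>W. \<exists>U\<in>\<U>. U `` {x} \<subseteq> W))"

definition finest_uniformity :: "'a topology \<Rightarrow> ('a \<times> 'a) set set \<Rightarrow> bool" where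
  "finest_uniformity X \<U> \<longleftrightarrow>
     compatible_uniformity X \<U> \<and> (\<forall>\<V>. compatible_uniformity X \<V> \<longrightarrow> \<V> \<subseteq> \<U>)"

definition cauchy_filter_unif :: "'a set \<Rightarrow> ('a \<times> 'a) set set \<Rightarrow> 'a filter \<Rightarrow> bool" where
  "cauchy_filter_unif S \<U> F \<longleftrightarrow>
     F \<noteq> bot \<and> eventually (\<lambda>x. x \<in> S) F \<and>
     (\<forall>U\<in>\<U>. \<exists>A. eventually (\<lambda>x. x \<in> A) F \<and> A \<times> A \<subseteq> U)"

definition complete_wrt :: "'a topology \<Rightarrow> ('a \<times> 'a) set set \<Rightarrow> bool" where
  "complete_wrt X \<U> \<longleftrightarrow>
     (\<forall>F. cauchy_filter_unif (topspace X) \<U> F \<longrightarrow> (\<exists>x. limitin X id x F))"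

definition tychonoff_space :: "'a topology \<Rightarrow> bool" where
  "tychonoff_space X \<longleftrightarrow> completely_regular_space X \<and> Hausdorff_space X"

definition topologically_complete :: "'a topology \<Rightarrow> bool" where
  "topologically_complete X \<longleftrightarrow>
     tychonoff_space X \<and> (\<exists>\<U>. finest_uniformity X \<U> \<and> complete_wrt X \<U>)"

definition partition_of_unity_for :: "'a topology \<Rightarrow> 'a set set \<Rightarrow> ('a set \<Rightarrow> 'a \<Rightarrow> real) \<Rightarrow> bool" where
  "partition_of_unity_for X \<alpha> \<phi> \<longleftrightarrow>
     (\<forall>V\<in>\<alpha>. continuous_map X euclideanreal (\<phi> V) \<and>
              (\<forall>x\<in>topspace X. 0 \<le> \<phi> V x \<and> \<phi> V x \<le> 1) \<and>
              X closure_of {x\<in>topspace X. 0 < \<phi> V x} \<subseteq> X interior_of V) \<and>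
     (\<forall>x\<in>topspace X. finite {V\<in>\<alpha>. \<phi> V x \<noteq> 0} \<and>
                     (\<Sum>V\<in>{V\<in>\<alpha>. \<phi> V x \<noteq> 0}. \<phi> V x) = 1)"

definition clfn_cover :: "'a topology \<Rightarrow> 'a set set \<Rightarrow> bool" where
  "clfn_cover X \<alpha> \<longleftrightarrow>
     (\<forall>V\<in>\<alpha>. closedin X V) \<and> \<Union>\<alpha> = topspace X \<and> locally_finite_in X \<alpha> \<and>
     (\<exists>\<phi>. partition_of_unity_for X \<alpha> \<phi>)"

definition refines :: "'a set set \<Rightarrow> 'a set set \<Rightarrow> bool" where
  "refines \<alpha> \<beta> \<longleftrightarrow> (\<forall>A\<in>\<alpha>. \<exists>B\<in>\<beta>. A \<subseteq> B)"

definition cofinal_clfn :: "'a topology \<Rightarrow> 'a set set set \<Rightarrow> bool" where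
  "cofinal_clfn X \<A> \<longleftrightarrow>
     (\<forall>\<alpha>\<in>\<A>. clfn_cover X \<alpha>) \<and> (\<forall>\<beta>. clfn_cover X \<beta> \<longrightarrow> (\<exists>\<alpha>\<in>\<A>. refines \<alpha> \<beta>))"

definition directed_set :: "'i set \<Rightarrow> ('i \<Rightarrow> 'i \<Rightarrow> bool) \<Rightarrow> bool" where
  "directed_set I le \<longleftrightarrow> I \<noteq> {} \<and> (\<forall>a\<in>I. le a a) \<and>
     (\<forall>a\<in>I. \<forall>b\<in>I. \<forall>c\<in>I. le a b \<and> le b c \<longrightarrow> le a c) \<and>
     (\<forall>a\<in>I. \<forall>b\<in>I. \<exists>c\<in>I. le a c \<and> le b c)"

definition inverse_system_graphs ::
  "'i set \<Rightarrow> ('i \<Rightarrow> 'i \<Rightarrow> bool) \<Rightarrow> ('i \<Rightarrow> 'v set) \<Rightarrow> ('i \<Rightarrow> 'v rel) \<Rightarrow> ('i \<Rightarrow> 'i \<Rightarrow> 'v \<Rightarrow> 'v) \<Rightarrow> bool" where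
  "inverse_system_graphs I le G r p \<longleftrightarrow>
     directed_set I le \<and>
     (\<forall>l\<in>I. r l \<subseteq> G l \<times> G l \<and> (\<forall>a\<in>G l. (a, a) \<in> r l) \<and> sym (r l)) \<and>
     (\<forall>l\<in>I. \<forall>a\<in>G l. p l l a = a) \<and>
     (\<forall>l\<in>I. \<forall>m\<in>I. le l m \<longrightarrow> p m l ` G m \<subseteq> G l) \<and>
     (\<forall>l\<in>I. \<forall>m\<in>I. \<forall>n\<in>I. le l m \<and> le m n \<longrightarrow> (\<forall>a\<in>G n. p m l (p n m a) = p n l a)) \<and>
     (\<forall>l\<in>I. \<forall>m\<in>I. le l m \<longrightarrow> (\<forall>a b. (a, b) \<in> r m \<longrightarrow> (p m l a, p m l b) \<in> r l))"

definition inv_limit ::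
  "'i set \<Rightarrow> ('i \<Rightarrow> 'i \<Rightarrow> bool) \<Rightarrow> ('i \<Rightarrow> 'v set) \<Rightarrow> ('i \<Rightarrow> 'i \<Rightarrow> 'v \<Rightarrow> 'v) \<Rightarrow> ('i \<Rightarrow> 'v) set" where
  "inv_limit I le G p =
     {z \<in> PiE I G. \<forall>l\<in>I. \<forall>m\<in>I. le l m \<longrightarrow> p m l (z m) = z l}"

definition star_set :: "'v rel \<Rightarrow> 'v set \<Rightarrow> 'v set" where
  "star_set r A = {b. \<exists>a\<in>A. (a, b) \<in> r}"

definition cell_structure ::
  "'i set \<Rightarrow> ('i \<Rightarrow> 'i \<Rightarrow> bool) \<Rightarrow> ('i \<Rightarrow> 'v set) \<Rightarrow> ('i \<Rightarrow> 'v rel) \<Rightarrow> ('i \<Rightarrow> 'i \<Rightarrow> 'v \<Rightarrow> 'v) \<Rightarrow> bool" where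
  "cell_structure I le G r p \<longleftrightarrow>
     inverse_system_graphs I le G r p \<and>
     (\<forall>z\<in>inv_limit I le G p. \<forall>l\<in>I.
        (\<exists>m\<in>I. le l m \<and>
           p m l ` star_set (r m) (star_set (r m) {z m}) \<subseteq> star_set (r l) {z l}) \<and>
        (\<exists>m\<in>I. le l m \<and> finite (p m l ` star_set (r m) {z m})))"

definition thread_equiv ::
  "'i set \<Rightarrow> ('i \<Rightarrow> 'v rel) \<Rightarrow> ('i \<Rightarrow> 'v) \<Rightarrow> ('i \<Rightarrow> 'v) \<Rightarrow> bool" where
  "thread_equiv I r z z' \<longleftrightarrow> (\<forall>l\<in>I. (z l, z' l) \<in> r l)"

definition cauchy_net ::
  "'i set \<Rightarrow> ('i \<Rightarrow> 'i \<Rightarrow> bool) \<Rightarrow> ('i \<Rightarrow> 'v set) \<Rightarrow> ('i \<Rightarrow> 'v rel) \<Rightarrow> ('i \<Rightarrow> 'i \<Rightarrow> 'v \<Rightarrow> 'v) \<Rightarrow> ('i \<Rightarrow> 'v) \<Rightarrow> bool" where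
  "cauchy_net I le G r p y \<longleftrightarrow>
     (\<forall>l\<in>I. y l \<in> G l) \<and>
     (\<exists>l\<in>I. \<forall>l0\<in>I. \<forall>l1\<in>I. \<forall>l2\<in>I.
         le l l1 \<and> le l0 l1 \<and> le l l2 \<and> le l0 l2 \<longrightarrow>
         (p l1 l0 (y l1), p l2 l0 (y l2)) \<in> r l0)"

definition net_converges_to ::
  "'i set \<Rightarrow> ('i \<Rightarrow> 'i \<Rightarrow> bool) \<Rightarrow> ('i \<Rightarrow> 'v rel) \<Rightarrow> ('i \<Rightarrow> 'v) \<Rightarrow> ('i \<Rightarrow> 'v) \<Rightarrow> bool" where
  "net_converges_to I le r y z \<longleftrightarrow> (\<exists>l\<in>I. \<forall>m\<in>I. le l m \<longrightarrow> (y m, z m) \<in> r m)"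

definition complete_cell_structure ::
  "'i set \<Rightarrow> ('i \<Rightarrow> 'i \<Rightarrow> bool) \<Rightarrow> ('i \<Rightarrow> 'v set) \<Rightarrow> ('i \<Rightarrow> 'v rel) \<Rightarrow> ('i \<Rightarrow> 'i \<Rightarrow> 'v \<Rightarrow> 'v) \<Rightarrow> bool" where
  "complete_cell_structure I le G r p \<longleftrightarrow>
     cell_structure I le G r p \<and>
     (\<forall>y. cauchy_net I le G r p y \<longrightarrow>
          (\<exists>z\<in>inv_limit I le G p. net_converges_to I le r y z))"

definition limit_topology ::
  "'i set \<Rightarrow> ('i \<Rightarrow> 'i \<Rightarrow> bool) \<Rightarrow> ('i \<Rightarrow> 'v set) \<Rightarrow> ('i \<Rightarrow> 'i \<Rightarrow> 'v \<Rightarrow> 'v) \<Rightarrow> ('i \<Rightarrow> 'v) topology" where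
  "limit_topology I le G p =
     subtopology (product_topology (\<lambda>l. discrete_topology (G l)) I) (inv_limit I le G p)"

definition quotient_topology :: "'a topology \<Rightarrow> ('a \<Rightarrow> 'b) \<Rightarrow> 'b topology" where
  "quotient_topology T q =
     topology (\<lambda>U. U \<subseteq> q ` topspace T \<and> openin T {x \<in> topspace T. q x \<in> U})"

definition thread_class ::
  "'i set \<Rightarrow> ('i \<Rightarrow> 'i \<Rightarrow> bool) \<Rightarrow> ('i \<Rightarrow> 'v set) \<Rightarrow> ('i \<Rightarrow> 'v rel) \<Rightarrow> ('i \<Rightarrow> 'i \<Rightarrow> 'v \<Rightarrow> 'v) \<Rightarrow> ('i \<Rightarrow> 'v) \<Rightarrow> ('i \<Rightarrow> 'v) set" where
  "thread_class I le G r p z = {z' \<in> inv_limit I le G p. thread_equiv I r z z'}"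

definition quotient_of_limit ::
  "'i set \<Rightarrow> ('i \<Rightarrow> 'i \<Rightarrow> bool) \<Rightarrow> ('i \<Rightarrow> 'v set) \<Rightarrow> ('i \<Rightarrow> 'v rel) \<Rightarrow> ('i \<Rightarrow> 'i \<Rightarrow> 'v \<Rightarrow> 'v) \<Rightarrow> ('i \<Rightarrow> 'v) set topology" where
  "quotient_of_limit I le G r p =
     quotient_topology (limit_topology I le G p) (thread_class I le G r p)"

text \<open>Index set Lambda: finite subsets of \<A>, directed by inclusion.\<close>
definition Lam :: "'a set set set \<Rightarrow> 'a set set set set" where
  "Lam \<A> = {l. finite l \<and> l \<subseteq> \<A>}"

text \<open>wedge v = intersection of v(alpha) over alpha in l (the empty intersection is X).\<close>
definition wedge :: "'a topology \<Rightarrow> 'a set set set \<Rightarrow> ('a set set \<Rightarrow> 'a set) \<Rightarrow> 'a set" where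
  "wedge X l v = topspace X \<inter> (\<Inter>\<alpha>\<in>l. v \<alpha>)"

definition N0 :: "'a topology \<Rightarrow> 'a set set set \<Rightarrow> ('a set set \<Rightarrow> 'a set) set" where
  "N0 X l = {v \<in> PiE l (\<lambda>\<alpha>. \<alpha>). wedge X l v \<noteq> {}}"

definition r0 :: "'a topology \<Rightarrow> 'a set set set \<Rightarrow> ('a set set \<Rightarrow> 'a set) rel" where
  "r0 X l = {(u, v). u \<in> N0 X l \<and> v \<in> N0 X l \<and> wedge X l u \<inter> wedge X l v \<noteq> {}}"

definition pi0 :: "'a set set set \<Rightarrow> 'a set set set \<Rightarrow> ('a set set \<Rightarrow> 'a set) \<Rightarrow> ('a set set \<Rightarrow> 'a set)" where
  "pi0 m l v = restrict v l"

definition pi_point :: "'a topology \<Rightarrow> 'a set set set \<Rightarrow> ('a set set set \<Rightarrow> 'a set set \<Rightarrow> 'a set) \<Rightarrow> 'a" where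
  "pi_point X \<A> z = (THE x. x \<in> (\<Inter>l\<in>Lam \<A>. wedge X l (z l)))"

end

theory Submission
  imports Defs
begin

text \<open>A thread determines a nested family of nonempty closed sets. Every entourage $U$ of the complete
  uniformity admits a closed, locally finite, normal cover by $U$-small sets, so this family is Cauchy
  and shrinks to a point. Functions separating a point from a closed set give covers in which the
  iterated star of a vertex over $x$ restricts to vertices whose sets all contain $x$; this yields the
  cell structure axioms and identifies equivalence of threads with equality of their points. Over each
  point the choices of members form a compact product of finite sets; compactness produces limits of
  Cauchy nets and shows that the projection to $X$ is a quotient map.\<close>

section \<open>Covers from locally finite superlevel sets\<close>

text \<open>The small covers are the hard part. The functions attached to an entourage are indexed
  by all points of \<open>X\<close>; their positivity sets cover \<open>X\<close> but need not be
  locally finite. Well-ordering the indices and keeping only what each function adds to the supremum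
  of the earlier ones cures this: finitely many increments at a point add up to at most 1, so only
  finitely many reach a given positive bound, and equicontinuity carries this to a neighbourhood.
  Both uses of compactness answer a lack of uniformity. For a Cauchy net the limit point
  \<open>x\<close> is found in the sets of \<open>y m\<close> only for \<open>m\<close> far beyond
  \<open>l\<close>, while convergence asks for adjacency at \<open>l\<close> itself; hence the limit
  thread is assembled from restrictions of such terms \<open>y m\<close>. Likewise, openness in the
  limit space supplies an index for each thread separately, while a neighbourhood of
  \<open>x\<close> requires one index for the whole fibre over \<open>x\<close>.\<close>

text \<open>The margin between the levels 0 and 1 makes the cover normal: the excess of
  \<open>g i\<close> over 1 is supported in the closed set where \<open>g i\<close> is at least 1,
  which lies in the open set where \<open>g i\<close> is positive, hence in the interior of the
  member. Dividing by the locally finite total gives the partition of unity.\<close>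

lemma clfn_cover_superlevel:
  fixes g :: "'i \<Rightarrow> 'a \<Rightarrow> real"
  assumes cont: "\<And>i. i \<in> I \<Longrightarrow> continuous_map X euclideanreal (g i)"
    and fin: "\<And>x. x \<in> topspace X \<Longrightarrow> \<exists>W. openin X W \<and> x \<in> W \<and> finite {i\<in>I. \<exists>y\<in>W. 0 \<le> g i y}"
    and big: "\<And>x. x \<in> topspace X \<Longrightarrow> \<exists>i\<in>I. 1 < g i x"
  shows "clfn_cover X ((\<lambda>i. {x\<in>topspace X. 0 \<le> g i x}) ` I)"
proof -
  define C where "C i = {x\<in>topspace X. 0 \<le> g i x}" for i
  \<comment> \<open>Partition functions are indexed by sets, and different indices may define the
    same set, so the indices of one set are pooled.\<close>
  define J where "J V = {i\<in>I. C i = V}" for V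
  define k where "k i x = max 0 (g i x - 1)" for i x
  define T where "T x = (\<Sum>i\<in>{i\<in>I. x \<in> C i}. k i x)" for x
  define \<phi> where "\<phi> V x = (\<Sum>i\<in>J V. k i x) / T x" for V x
  have k0: "0 \<le> k i x" for i x by (simp add: k_def)
  have kC: "x \<in> topspace X \<Longrightarrow> k i x \<noteq> 0 \<Longrightarrow> x \<in> C i" for i x
    by (auto simp: k_def C_def max_def split: if_splits)
  have finC: "finite {i\<in>I. x \<in> C i}" if x: "x \<in> topspace X" for x
  proof -
    obtain W where W: "x \<in> W" "finite {i\<in>I. \<exists>y\<in>W. 0 \<le> g i y}"
      using fin[OF x] by blast
    show ?thesis
      by (rule finite_subset[OF _ W(2)]) (use W(1) in \<open>auto simp: C_def\<close>)
  qed
  have finJ: "finite (J V)" if V: "V \<noteq> {}" "V \<subseteq> topspace X" for V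
  proof -
    obtain x where "x \<in> V" using V by blast
    then show ?thesis
      using finite_subset[OF _ finC, of "J V" x] V by (auto simp: J_def)
  qed
  have Tpos: "0 < T x" if x: "x \<in> topspace X" for x
  proof -
    obtain i where i: "i \<in> I" "1 < g i x" using big[OF x] by blast
    then have "0 < k i x" "x \<in> C i" using x by (auto simp: k_def C_def)
    then show ?thesis
      unfolding T_def using finC[OF x] i k0 by (intro sum_pos2[of _ i]) auto
  qed
  have contk: "continuous_map X euclideanreal (k i)" if "i \<in> I" for i
    unfolding k_def by (intro continuous_intros cont that)
  have contT: "continuous_map X euclideanreal T"
  proof -
    obtain W where W: "\<And>x. x \<in> topspace X \<Longrightarrow> openin X (W x) \<and> x \<in> W x \<and> finite {i\<in>I. \<exists>y\<in>W x. 0 \<le> g i y}"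
      using fin by metis
    define F where "F x = {i\<in>I. \<exists>y\<in>W x. 0 \<le> g i y}" for x
    \<comment> \<open>The index set in \<open>T\<close> varies with the point; near \<open>x\<close>
      one fixed finite set replaces it, since the added terms vanish.\<close>
    have FT: "(\<Sum>i\<in>F x. k i y) = T y" if "x \<in> topspace X" "y \<in> topspace X" "y \<in> W x" for x y
      unfolding T_def
    proof (rule sum.mono_neutral_right)
      show "finite (F x)" using W[OF that(1)] by (simp add: F_def)
      show "{i \<in> I. y \<in> C i} \<subseteq> F x" using that by (auto simp: F_def C_def)
      show "\<forall>i\<in>F x - {i \<in> I. y \<in> C i}. k i y = 0" using kC that by (auto simp: F_def)
    qed
    show ?thesis
    proof (rule pasting_lemma[where I = "topspace X" and T = W and f = "\<lambda>x y. \<Sum>i\<in>F x. k i y"])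
      show "continuous_map (subtopology X (W x)) euclideanreal (\<lambda>y. \<Sum>i\<in>F x. k i y)"
        if "x \<in> topspace X" for x
        using W[OF that]
        by (intro continuous_map_from_subtopology continuous_map_sum contk) (auto simp: F_def)
    qed (use W FT in \<open>auto\<close>)
  qed
  have clC: "closedin X (C i)" if "i \<in> I" for i
    using closedin_continuous_map_preimage[OF cont[OF that], of "{0..}"] by (simp add: C_def)
  have locfin: "locally_finite_in X (C ` I)"
    unfolding locally_finite_in_def
  proof (intro conjI ballI)
    show "\<Union> (C ` I) \<subseteq> topspace X" by (auto simp: C_def)
    fix x assume "x \<in> topspace X"
    then obtain W where W: "openin X W" "x \<in> W" "finite {i\<in>I. \<exists>y\<in>W. 0 \<le> g i y}"
      using fin by blast
    have "{U \<in> C ` I. U \<inter> W \<noteq> {}} \<subseteq> C ` {i\<in>I. \<exists>y\<in>W. 0 \<le> g i y}"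
      by (auto simp: C_def)
    with W show "\<exists>V. openin X V \<and> x \<in> V \<and> finite {U \<in> C ` I. U \<inter> V \<noteq> {}}"
      using finite_surj by blast
  qed
  have union: "\<Union> (C ` I) = topspace X"
  proof
    show "topspace X \<subseteq> \<Union> (C ` I)"
    proof
      fix x assume x: "x \<in> topspace X"
      then obtain i where "i \<in> I" "1 < g i x" using big by blast
      then show "x \<in> \<Union> (C ` I)" using x by (auto simp: C_def intro!: bexI[of _ i])
    qed
  qed (auto simp: C_def)
  have phi0: "0 \<le> \<phi> V x" if "x \<in> topspace X" for V x
    unfolding \<phi>_def using Tpos[OF that] k0 by (simp add: sum_nonneg)
  have phiV: "x \<in> V" if x: "x \<in> topspace X" and nz: "\<phi> V x \<noteq> 0" for V x
  proof -
    have "(\<Sum>i\<in>J V. k i x) \<noteq> 0" using nz by (auto simp: \<phi>_def)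
    then obtain i where "i \<in> J V" "k i x \<noteq> 0" by (meson sum.neutral)
    then show ?thesis using kC[OF x] by (auto simp: J_def)
  qed
  have phisum: "finite {V\<in>C ` I. \<phi> V x \<noteq> 0}" "(\<Sum>V\<in>{V\<in>C ` I. \<phi> V x \<noteq> 0}. \<phi> V x) = 1"
    if x: "x \<in> topspace X" for x
  proof -
    let ?A = "{i\<in>I. x \<in> C i}"
    have sub: "{V\<in>C ` I. \<phi> V x \<noteq> 0} \<subseteq> C ` ?A" using phiV[OF x] by auto
    then show "finite {V\<in>C ` I. \<phi> V x \<noteq> 0}" using finC[OF x] finite_surj by blast
    have "(\<Sum>V\<in>{V\<in>C ` I. \<phi> V x \<noteq> 0}. \<phi> V x) = (\<Sum>V\<in>C ` ?A. \<phi> V x)"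
      by (rule sum.mono_neutral_left) (use sub finC[OF x] in auto)
    also have "\<dots> = (\<Sum>V\<in>C ` ?A. (\<Sum>i\<in>{i. i \<in> ?A \<and> C i = V}. k i x) / T x)"
    proof (rule sum.cong[OF refl])
      fix V assume "V \<in> C ` ?A"
      then have "J V = {i. i \<in> ?A \<and> C i = V}" by (auto simp: J_def)
      then show "\<phi> V x = (\<Sum>i\<in>{i. i \<in> ?A \<and> C i = V}. k i x) / T x" by (simp only: \<phi>_def)
    qed
    also have "\<dots> = 1"
      unfolding sum_divide_distrib[symmetric] sum.image_gen[OF finC[OF x], of "\<lambda>i. k i x" C, symmetric]
      using Tpos[OF x] T_def by simp
    finally show "(\<Sum>V\<in>{V\<in>C ` I. \<phi> V x \<noteq> 0}. \<phi> V x) = 1" .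
  qed
  have "partition_of_unity_for X (C ` I) \<phi>"
    unfolding partition_of_unity_for_def
  proof (intro conjI ballI)
    fix V assume V: "V \<in> C ` I"
    have "continuous_map X euclideanreal (\<lambda>x. \<Sum>i\<in>J V. k i x)"
    \<comment> \<open>An infinite \<open>J V\<close> can only belong to the empty set; the sum is
      then 0 by convention.\<close>
    proof (cases "finite (J V)")
      case True
      then show ?thesis by (intro continuous_map_sum contk) (auto simp: J_def)
    qed simp
    then show "continuous_map X euclideanreal (\<phi> V)"
      unfolding \<phi>_def by (intro continuous_map_real_divide contT) (use Tpos in force)+
    show "X closure_of {x \<in> topspace X. 0 < \<phi> V x} \<subseteq> X interior_of V"
    proof (cases "V = {}")
      case True
      then have "{x \<in> topspace X. 0 < \<phi> V x} = {}" using phiV by force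
      then show ?thesis by (simp only: closure_of_empty empty_subsetI)
    next
      case False
      moreover have "V \<subseteq> topspace X" using V by (auto simp: C_def)
      ultimately have fJ: "finite (J V)" by (rule finJ)
      let ?D = "\<Union>i\<in>J V. {x\<in>topspace X. g i x \<in> {1..}}"
      let ?O = "\<Union>i\<in>J V. {x\<in>topspace X. g i x \<in> {0<..}}"
      have contJ: "continuous_map X euclideanreal (g i)" if "i \<in> J V" for i
        using that cont by (simp add: J_def)
      have "closedin X {x\<in>topspace X. g i x \<in> {1..}}" if "i \<in> J V" for i
        by (rule closedin_continuous_map_preimage[OF contJ[OF that]]) simp
      then have "closedin X ?D" using fJ by (intro closedin_Union) (simp_all, blast)
      moreover have "{x \<in> topspace X. 0 < \<phi> V x} \<subseteq> ?D"
      proof clarify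
        fix x assume x: "x \<in> topspace X" "0 < \<phi> V x"
        then have "(\<Sum>i\<in>J V. k i x) \<noteq> 0" by (auto simp: \<phi>_def)
        then obtain i where "i \<in> J V" "k i x \<noteq> 0" by (meson sum.neutral)
        then show "x \<in> ?D" using x by (auto simp: k_def max_def split: if_splits)
      qed
      ultimately have "X closure_of {x \<in> topspace X. 0 < \<phi> V x} \<subseteq> ?D"
        by (simp add: closure_of_minimal)
      also have "\<dots> \<subseteq> ?O" by force
      also have "\<dots> \<subseteq> X interior_of V"
      proof (rule interior_of_maximal)
        have "openin X {x\<in>topspace X. g i x \<in> {0<..}}" if "i \<in> J V" for i
          by (rule openin_continuous_map_preimage[OF contJ[OF that]]) simp
        then show "openin X ?O" by (intro openin_Union) blast
        show "?O \<subseteq> V" by (auto simp: J_def C_def)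
      qed
      finally show ?thesis .
    qed
    fix x assume x: "x \<in> topspace X"
    show "0 \<le> \<phi> V x" using phi0[OF x] .
    show "\<phi> V x \<le> 1"
    proof (cases "\<phi> V x = 0")
      case False
      then have "\<phi> V x \<le> (\<Sum>V\<in>{V\<in>C ` I. \<phi> V x \<noteq> 0}. \<phi> V x)"
        using phisum[OF x] phi0[OF x] V by (intro member_le_sum) auto
      then show ?thesis using phisum[OF x] by simp
    qed simp
  next
    fix x assume x: "x \<in> topspace X"
    show "finite {V\<in>C ` I. \<phi> V x \<noteq> 0}" "(\<Sum>V\<in>{V\<in>C ` I. \<phi> V x \<noteq> 0}. \<phi> V x) = 1"
      using phisum[OF x] by auto
  qed
  then have "clfn_cover X (C ` I)"
    unfolding clfn_cover_def using clC union locfin by auto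
  then show ?thesis by (simp add: C_def)
qed

text \<open>Intended for separation: a set inside a member of this cover that contains a point with
  \<open>f\<close> below \<open>a\<close> must lie where \<open>f\<close> is at most
  \<open>b\<close>.\<close>

lemma clfn_cover_two_sets:
  assumes f: "continuous_map X euclideanreal f" and ab: "a < b"
  shows "clfn_cover X {{x\<in>topspace X. a \<le> f x}, {x\<in>topspace X. f x \<le> b}}"
proof -
  \<comment> \<open>The factor 4 makes the two functions add up to 4, so at every point one of them
    is at least 2 and passes the level 1.\<close>
  define g where "g i x = (if i then 4 * (f x - a) / (b - a) else 4 * (b - f x) / (b - a))" for i :: bool and x
  have "clfn_cover X ((\<lambda>i. {x\<in>topspace X. 0 \<le> g i x}) ` UNIV)"
  proof (rule clfn_cover_superlevel)
    show "continuous_map X euclideanreal (g i)" for i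
      unfolding g_def using ab by (cases i) (auto intro!: continuous_intros f)
    show "\<exists>W. openin X W \<and> x \<in> W \<and> finite {i\<in>UNIV. \<exists>y\<in>W. 0 \<le> g i y}" if "x \<in> topspace X" for x
      using that by (intro exI[of _ "topspace X"]) auto
    show "\<exists>i\<in>UNIV. 1 < g i x" for x
    proof -
      have "g True x + g False x = 4"
        using ab by (simp add: g_def flip: add_divide_distrib) (simp add: field_simps)
      then have "1 < g True x \<or> 1 < g False x" by linarith
      then show ?thesis by blast
    qed
  qed
  moreover have "(\<lambda>i. {x\<in>topspace X. 0 \<le> g i x}) ` UNIV = {{x\<in>topspace X. a \<le> f x}, {x\<in>topspace X. f x \<le> b}}"
  proof -
    have "0 \<le> g True x \<longleftrightarrow> a \<le> f x" "0 \<le> g False x \<longleftrightarrow> f x \<le> b" for x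
      using ab by (auto simp: g_def zero_le_divide_iff)
    then show ?thesis by (auto simp: UNIV_bool)
  qed
  ultimately show ?thesis by simp
qed

section \<open>Increments along a well-order and chains of entourages\<close>

text \<open>The gain of the running supremum at index \<open>i\<close>. The inserted 0 keeps the set
  nonempty at the least index and starts the supremum at 0.\<close>

definition increment :: "('i \<Rightarrow> 'i \<Rightarrow> bool) \<Rightarrow> ('i \<Rightarrow> real) \<Rightarrow> 'i \<Rightarrow> real" where
  "increment lt f i = max 0 (f i - Sup (insert 0 (f ` {j. lt j i})))"

lemma increment_nonneg: "0 \<le> increment lt f i"
  by (simp add: increment_def)

lemma Sup_insert_upper:
  fixes f :: "'i \<Rightarrow> real"
  assumes "\<And>i. f i \<le> c"
  shows "0 \<le> Sup (insert 0 (f ` A))" "i \<in> A \<Longrightarrow> f i \<le> Sup (insert 0 (f ` A))"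
proof -
  have "bdd_above (f ` A)" by (rule bdd_aboveI2[where M = c]) (rule assms)
  then show "0 \<le> Sup (insert 0 (f ` A))" "i \<in> A \<Longrightarrow> f i \<le> Sup (insert 0 (f ` A))"
    by (auto intro!: cSup_upper)
qed

lemma Sup_perturb:
  fixes f g :: "'i \<Rightarrow> real"
  assumes "\<And>i. g i \<le> c" "\<And>i. f i \<le> g i + e" "0 \<le> e"
  shows "Sup (insert 0 (f ` A)) \<le> Sup (insert 0 (g ` A)) + e"
proof (rule cSup_least)
  fix y assume "y \<in> insert 0 (f ` A)"
  then consider "y = 0" | i where "i \<in> A" "y = f i" by blast
  then show "y \<le> Sup (insert 0 (g ` A)) + e"
  proof cases
    case 1
    then show ?thesis using Sup_insert_upper(1)[of g c A] assms by simp
  next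
    case (2 i)
    have "g i \<le> Sup (insert 0 (g ` A))" by (rule Sup_insert_upper(2)[of g c]) (use 2 assms in auto)
    then show ?thesis using 2 assms(2)[of i] by simp
  qed
qed simp

lemma increment_le:
  assumes "\<And>i. 0 \<le> f i" "\<And>i. f i \<le> c"
  shows "increment lt f i \<le> f i"
  using assms Sup_insert_upper(1)[of f c] by (simp add: increment_def)

text \<open>The value and the running supremum each move by at most \<open>e\<close>, whence the
  factor 2. The bound does not depend on the index, so equicontinuity passes from a family to its
  increments.\<close>

lemma increment_perturb:
  assumes "\<And>i. f i \<le> c" "\<And>i. g i \<le> c" "\<And>i. \<bar>f i - g i\<bar> \<le> e"
  shows "\<bar>increment lt f i - increment lt g i\<bar> \<le> 2 * e"
proof -
  have e: "0 \<le> e" using assms(3)[of i] by linarith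
  let ?F = "Sup (insert 0 (f ` {j. lt j i}))" and ?G = "Sup (insert 0 (g ` {j. lt j i}))"
  have "f j \<le> g j + e" "g j \<le> f j + e" for j using assms(3)[of j] by linarith+
  then have "?F \<le> ?G + e" "?G \<le> ?F + e"
    using e assms by (blast intro: Sup_perturb)+
  then show ?thesis using assms(3)[of i] e unfolding increment_def by linarith
qed

text \<open>The increments along an increasing family of finitely many indices telescope.\<close>
lemma sum_increment_le:
  assumes lt: "transp lt" "asymp lt" "totalp lt"
    and f: "\<And>i. f i \<le> c"
    and "finite J" "0 \<le> b" "\<And>i j. j \<in> J \<Longrightarrow> i = j \<or> lt i j \<Longrightarrow> f i \<le> b"
  shows "sum (increment lt f) J \<le> b"
  using assms(5-)
proof (induction "card J" arbitrary: J b)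
  case 0
  then show ?case by simp
next
  case (Suc n)
  then have "J \<noteq> {}" by auto
  then obtain m where m: "m \<in> J" "\<And>x. x \<in> J \<Longrightarrow> x \<noteq> m \<Longrightarrow> \<not> lt m x"
    using Finite_Set.bex_max_element[OF Suc.prems(1) asymp_on_subset[OF lt(2) subset_UNIV]
      transp_on_subset[OF lt(1) subset_UNIV]] by blast
  have lm: "lt x m" if "x \<in> J - {m}" for x
    using m that lt(3) by (auto simp: totalp_on_def)
  \<comment> \<open>The running supremum before the last index \<open>m\<close> bounds the sum of
    the other increments by induction, and the increment at \<open>m\<close> uses at most the
    remaining \<open>b - s\<close>.\<close>
  define s where "s = Sup (insert 0 (f ` {j. lt j m}))"
  have s0: "0 \<le> s" unfolding s_def by (rule Sup_insert_upper(1)[of f c]) (rule f)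
  have fs: "f i \<le> s" if "lt i m" for i unfolding s_def
    by (rule Sup_insert_upper(2)[of f c]) (use that f in auto)
  have sb: "s \<le> b" unfolding s_def
    by (rule cSup_least) (use Suc.prems m in auto)
  have "sum (increment lt f) (J - {m}) \<le> s"
  proof (rule Suc.hyps(1))
    show "n = card (J - {m})" using Suc.hyps(2) Suc.prems(1) m(1) by simp
    show "f i \<le> s" if "j \<in> J - {m}" "i = j \<or> lt i j" for i j
      using lm[OF that(1)] that(2) fs lt(1) by (metis transpE)
  qed (use Suc.prems s0 in auto)
  moreover have "increment lt f m \<le> b - s"
    using Suc.prems(3)[OF m(1), of m] sb by (simp add: increment_def s_def)
  ultimately show ?case
    using sum.remove[OF Suc.prems(1) m(1), of "increment lt f"] by simp
qed

text \<open>By telescoping, \<open>n\<close> such indices would force \<open>n * e\<close> to be at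
  most 1. This is the source of local finiteness.\<close>

lemma finite_increment_ge:
  assumes lt: "transp lt" "asymp lt" "totalp lt"
    and f: "\<And>i. f i \<le> 1" and e: "0 < e"
  shows "finite {i. e \<le> increment lt f i}"
proof (rule ccontr)
  assume inf: "infinite {i. e \<le> increment lt f i}"
  obtain n :: nat where n: "1 < real n * e" using reals_Archimedean3[OF e] by blast
  obtain J where J: "finite J" "card J = n" "J \<subseteq> {i. e \<le> increment lt f i}"
    using infinite_arbitrarily_large[OF inf] by blast
  have "real n * e \<le> sum (increment lt f) J"
    using sum_bounded_below[of J e "increment lt f"] J by auto
  also have "\<dots> \<le> 1" by (rule sum_increment_le[OF lt f J(1)]) (use f in auto)
  finally show False using n by simp
qed

text \<open>At the least index with a positive value all earlier values vanish, so the increment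
  there is the whole value.\<close>

lemma increment_pos_exists:
  assumes "wfp lt" "\<And>i. 0 \<le> f i" "0 < f i"
  shows "\<exists>j. 0 < increment lt f j"
proof -
  obtain j where j: "0 < f j" "\<And>k. lt k j \<Longrightarrow> \<not> 0 < f k"
    using assms(1)[unfolded wfp_eq_minimal, rule_format, of i "{i. 0 < f i}"] assms(3) by blast
  have "f k = 0" if "lt k j" for k using j(2)[OF that] assms(2)[of k] by linarith
  then have "f ` {k. lt k j} \<subseteq> {0}" by blast
  then have e: "insert 0 (f ` {k. lt k j}) = {0}" by blast
  have "increment lt f j = f j" unfolding increment_def e using j(1) by simp
  then show ?thesis using j(1) by (intro exI[of _ j]) simp
qed

lemma exists_wellorder:
  obtains lt :: "'i \<Rightarrow> 'i \<Rightarrow> bool" where "wfp lt" "transp lt" "asymp lt" "totalp lt"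
proof -
  obtain r :: "'i rel" where r: "Well_order r" "Field r = UNIV" using well_ordering by metis
  define lt where "lt i j \<longleftrightarrow> (i, j) \<in> r - Id" for i j
  have "wf (r - Id)" using r by (simp add: well_order_on_def)
  moreover have "r - Id = {(i, j). lt i j}" by (auto simp: lt_def)
  ultimately have "wfp lt" unfolding wfp_def by simp
  have t: "trans r" and a: "antisym r" and tot: "total r"
      using r by (auto simp: well_order_on_def linear_order_on_def partial_order_on_def preorder_on_def)
  have "transp lt"
  proof (rule transpI)
    fix x y z assume "lt x y" "lt y z"
    then show "lt x z" using transD[OF t, of x y z] antisymD[OF a, of x y] by (auto simp: lt_def)
  qed
  moreover have "asymp lt" using antisymD[OF a] by (auto intro!: asympI simp: lt_def)
  moreover have "totalp lt" using tot by (auto simp: totalp_on_def total_on_def lt_def)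
  ultimately show ?thesis using \<open>wfp lt\<close> that by blast
qed

section \<open>Chains of entourages and their weights\<close>

primrec chain :: "'a set \<Rightarrow> (nat \<Rightarrow> 'a rel) \<Rightarrow> nat list \<Rightarrow> 'a rel" where
  "chain S U [] = Id_on S"
| "chain S U (n # ns) = U n O chain S U ns"

text \<open>A link in the \<open>n\<close>-th entourage costs \<open>(1/2) ^ n\<close>; the infimum
  over all chains between two points is the distance used in the classical metrization of
  uniformities.\<close>

abbreviation weight :: "nat list \<Rightarrow> real" where
  "weight ns \<equiv> sum_list (map (\<lambda>n. (1/2) ^ n) ns)"

lemma weight_nonneg: "0 \<le> weight ns"
  by (intro sum_list_nonneg) auto

lemma chain_subset:
  assumes "\<And>n. U n \<subseteq> S \<times> S"
  shows "chain S U ns \<subseteq> S \<times> S"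
proof (induction ns)
  case (Cons n ns)
  then show ?case using assms[of n] by auto
qed auto

lemma chain_append:
  assumes "\<And>n. U n \<subseteq> S \<times> S"
  shows "chain S U (as @ (bs :: nat list)) = chain S U as O chain S U bs"
proof (induction as)
  case Nil
  then show ?case using chain_subset[where U = U and S = S and ns = bs, OF assms] by auto
qed (simp add: O_assoc)

text \<open>Cut at the link during which the accumulated weight reaches \<open>t\<close>; with that
  link left out, both remaining parts stay within their share.\<close>

lemma weight_split:
  assumes "ns \<noteq> []" "0 \<le> t" "t \<le> weight ns"
  shows "\<exists>as b cs. ns = as @ b # cs \<and> weight as \<le> t \<and> weight cs \<le> weight ns - t"
  using assms
proof (induction ns arbitrary: t)
  case (Cons n ns)
  show ?case
  proof (cases "t \<le> (1/2) ^ n")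
    case True
    then show ?thesis
      using Cons.prems by (intro exI[of _ "[]"] exI[of _ n] exI[of _ ns]) auto
  next
    case False
    then have "ns \<noteq> []" using Cons.prems by auto
    moreover have "0 \<le> t - (1/2) ^ n" "t - (1/2) ^ n \<le> weight ns" using Cons.prems False by auto
    ultimately obtain as b cs where "ns = as @ b # cs" "weight as \<le> t - (1/2) ^ n"
        "weight cs \<le> weight ns - (t - (1/2) ^ n)"
      using Cons.IH by blast
    then show ?thesis
      by (intro exI[of _ "n # as"] exI[of _ b] exI[of _ cs]) auto
  qed
qed simp

text \<open>The chain lemma behind the metrization of uniformities: cut the chain at half of its weight.\<close>
lemma chain_subset_entourage:
  assumes US: "\<And>n. U n \<subseteq> S \<times> S" and refl: "\<And>n. Id_on S \<subseteq> U n"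
    and U3: "\<And>n. U (Suc n) O U (Suc n) O U (Suc n) \<subseteq> U n"
  shows "weight ns < (1/2) ^ n \<Longrightarrow> chain S U ns \<subseteq> U n"
proof (induction "length ns" arbitrary: ns n rule: less_induct)
  case less
  show ?case
  proof (cases "ns = []")
    case True
    then show ?thesis using refl by simp
  next
    case False
    have "0 \<le> weight ns / 2" "weight ns / 2 \<le> weight ns" using weight_nonneg[of ns] by linarith+
    from weight_split[OF False this]
    obtain as b cs where s: "ns = as @ b # cs" "weight as \<le> weight ns / 2"
        "weight cs \<le> weight ns - weight ns / 2"
      by blast
    have "weight as < (1/2) ^ Suc n" "weight cs < (1/2) ^ Suc n"
      using s(2,3) less.prems power_Suc[of "1/2::real" n] by linarith+
    then have "chain S U as \<subseteq> U (Suc n)" "chain S U cs \<subseteq> U (Suc n)"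
      using s(1) by (simp_all add: less.hyps)
    \<comment> \<open>The cut link may carry most of the weight, but a power of one half below
      \<open>(1/2) ^ n\<close> has exponent at least \<open>Suc n\<close>.\<close>
    moreover have "U b \<subseteq> U (Suc n)"
    proof -
      have "(1/2) ^ b \<le> weight ns" using s(1) weight_nonneg[of as] weight_nonneg[of cs] by simp
      then have "(1/2::real) ^ b < (1/2) ^ n" using less.prems by linarith
      then have "Suc n \<le> b" by (simp add: power_strict_decreasing_iff Suc_le_eq)
      moreover have "U (Suc k) \<subseteq> U k" for k
      proof
        fix p assume p: "p \<in> U (Suc k)"
        then have "fst p \<in> S" "snd p \<in> S" using US[of "Suc k"] by auto
        then have "(fst p, fst p) \<in> U (Suc k)" "(snd p, snd p) \<in> U (Suc k)" using refl by auto
        then show "p \<in> U k" using U3[of k] p by (cases p) auto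
      qed
      ultimately show ?thesis using lift_Suc_antimono_le[of U "Suc n" b] by blast
    qed
    ultimately have "chain S U ns \<subseteq> U (Suc n) O U (Suc n) O U (Suc n)"
      unfolding s(1) chain_append[OF US] chain.simps by (intro relcomp_mono)
    then show ?thesis using U3 by blast
  qed
qed

section \<open>Small covers for a compatible uniformity\<close>

lemma uniformity_on_subset:
  assumes "uniformity_on S \<U>" "U \<in> \<U>"
  shows "Id_on S \<subseteq> U" "U \<subseteq> S \<times> S"
  using assms by (simp_all add: uniformity_on_def)

lemma uniformity_on_half:
  assumes "uniformity_on S \<U>" "U \<in> \<U>"
  shows "\<exists>V\<in>\<U>. V O V \<subseteq> U"
  using assms(1)[unfolded uniformity_on_def] assms(2) by (elim conjE) (rule bspec)

lemma uniformity_on_symmetric_part: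
  assumes "uniformity_on S \<U>" "U \<in> \<U>"
  shows "U \<inter> converse U \<in> \<U>"
proof -
  have "\<forall>U\<in>\<U>. \<forall>V\<in>\<U>. U \<inter> V \<in> \<U>"
    using assms(1)[unfolded uniformity_on_def] by (elim conjE)
  moreover have "\<forall>U\<in>\<U>. converse U \<in> \<U>"
    using assms(1)[unfolded uniformity_on_def] by (elim conjE)
  ultimately show ?thesis using assms(2) by blast
qed

lemma uniformity_on_symmetric_third:
  assumes u: "uniformity_on S \<U>" and U: "U \<in> \<U>"
  shows "\<exists>V\<in>\<U>. converse V = V \<and> V O V O V \<subseteq> U"
proof -
  obtain V1 where V1: "V1 \<in> \<U>" "V1 O V1 \<subseteq> U" using uniformity_on_half[OF u U] by blast
  obtain V2 where V2: "V2 \<in> \<U>" "V2 O V2 \<subseteq> V1" using uniformity_on_half[OF u V1(1)] by blast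
  have V2s: "Id_on S \<subseteq> V2" "V2 \<subseteq> S \<times> S" using uniformity_on_subset[OF u V2(1)] .
  have sub: "V2 \<subseteq> V1"
  proof
    fix p assume "p \<in> V2"
    then show "p \<in> V1" using V2s V2(2) by (cases p) blast
  qed
  let ?V = "V2 \<inter> converse V2"
  have "?V \<in> \<U>" using uniformity_on_symmetric_part[OF u V2(1)] .
  moreover have "?V O ?V O ?V \<subseteq> V1 O V1" using V2(2) sub by blast
  ultimately show ?thesis using V1(2) by (intro bexI[of _ ?V]) auto
qed

lemma uniformity_on_normal_sequence:
  assumes u: "uniformity_on S \<U>" and U: "U \<in> \<U>"
  obtains V :: "nat \<Rightarrow> 'a rel" where "\<And>n. V n \<in> \<U>" "\<And>n. converse (V n) = V n"
    "\<And>n. V (Suc n) O V (Suc n) O V (Suc n) \<subseteq> V n" "V 0 \<subseteq> U"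
proof -
  have "\<exists>V. \<forall>n. (V n \<in> \<U> \<and> converse (V n) = V n \<and> (n = 0 \<longrightarrow> V n \<subseteq> U)) \<and> V (Suc n) O V (Suc n) O V (Suc n) \<subseteq> V n"
  proof (rule dependent_nat_choice)
    have "U \<inter> converse U \<in> \<U>" using uniformity_on_symmetric_part[OF u U] .
    then show "\<exists>V. V \<in> \<U> \<and> converse V = V \<and> (0 = 0 \<longrightarrow> V \<subseteq> U)"
      by (intro exI[of _ "U \<inter> converse U"]) auto
    show "\<exists>W. (W \<in> \<U> \<and> converse W = W \<and> (Suc n = 0 \<longrightarrow> W \<subseteq> U)) \<and> W O W O W \<subseteq> V"
      if "V \<in> \<U> \<and> converse V = V \<and> (n = 0 \<longrightarrow> V \<subseteq> U)" for V and n :: nat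
      using uniformity_on_symmetric_third[OF u, of V] that by blast
  qed
  then obtain V where "\<forall>n. (V n \<in> \<U> \<and> converse (V n) = V n \<and> (n = 0 \<longrightarrow> V n \<subseteq> U)) \<and> V (Suc n) O V (Suc n) O V (Suc n) \<subseteq> V n"
    by (elim exE)
  then show ?thesis by (intro that[of V]) simp_all
qed

lemma compatible_uniformity_neighbourhood:
  assumes c: "compatible_uniformity X \<U>" and U: "U \<in> \<U>" and x: "x \<in> topspace X"
  shows "\<exists>W. openin X W \<and> x \<in> W \<and> W \<subseteq> U `` {x}"
proof -
  have u: "uniformity_on (topspace X) \<U>" using c by (simp add: compatible_uniformity_def)
  have UX: "Id_on (topspace X) \<subseteq> V" "V \<subseteq> topspace X \<times> topspace X" if "V \<in> \<U>" for V
    using uniformity_on_subset[OF u that] .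
  let ?W = "{p\<in>topspace X. \<exists>V\<in>\<U>. V `` {p} \<subseteq> U `` {x}}"
  have "\<exists>V\<in>\<U>. V `` {p} \<subseteq> ?W" if p: "p \<in> ?W" for p
  proof -
    obtain V where V: "V \<in> \<U>" "V `` {p} \<subseteq> U `` {x}" using p by blast
    obtain V' where V': "V' \<in> \<U>" "V' O V' \<subseteq> V"
      using uniformity_on_half[OF u V(1)] by blast
    have "V' `` {p} \<subseteq> ?W"
    proof
      fix q assume q: "q \<in> V' `` {p}"
      have "V' `` {q} \<subseteq> U `` {x}" using q V'(2) V(2) by blast
      then show "q \<in> ?W" using q V'(1) UX(2)[OF V'(1)] by blast
    qed
    then show ?thesis using V' by blast
  qed
  moreover have "openin X W \<longleftrightarrow> W \<subseteq> topspace X \<and> (\<forall>x\<in>W. \<exists>U\<in>\<U>. U `` {x} \<subseteq> W)" for W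
    using c by (simp only: compatible_uniformity_def)
  ultimately have "openin X ?W" by blast
  moreover have "x \<in> ?W" using x U by blast
  moreover have "?W \<subseteq> U `` {x}" using UX(1) by blast
  ultimately show ?thesis by blast
qed

text \<open>Take 1 minus the chain distance truncated at 1. Appending one link of \<open>V n\<close>
  costs \<open>(1/2) ^ n\<close> whatever the starting point \<open>x\<close>, which gives
  equicontinuity in \<open>y\<close>; a positive value means a chain of weight below 1, and the
  chain lemma puts such pairs into \<open>V 0\<close>.\<close>

lemma entourage_equicontinuous_family:
  assumes U: "U \<in> \<U>" and c: "compatible_uniformity X \<U>"
  obtains f :: "'a \<Rightarrow> 'a \<Rightarrow> real" where
    "\<And>x y. 0 \<le> f x y" "\<And>x y. f x y \<le> 1" "\<And>x. x \<in> topspace X \<Longrightarrow> 0 < f x x"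
    "\<And>x y. 0 < f x y \<Longrightarrow> (x, y) \<in> U"
    "\<And>y e. y \<in> topspace X \<Longrightarrow> 0 < e \<Longrightarrow> \<exists>W. openin X W \<and> y \<in> W \<and> (\<forall>z\<in>W. \<forall>x. \<bar>f x y - f x z\<bar> \<le> e)"
proof -
  have u: "uniformity_on (topspace X) \<U>" using c by (simp add: compatible_uniformity_def)
  obtain V :: "nat \<Rightarrow> 'a rel" where V: "\<And>n. V n \<in> \<U>" "\<And>n. converse (V n) = V n"
    "\<And>n. V (Suc n) O V (Suc n) O V (Suc n) \<subseteq> V n" "V 0 \<subseteq> U"
    by (rule uniformity_on_normal_sequence[OF u U]) (rule that)
  have VX: "Id_on (topspace X) \<subseteq> V n" "V n \<subseteq> topspace X \<times> topspace X" for n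
    using uniformity_on_subset[OF u V(1)] .
  \<comment> \<open>The entry 1 truncates the distance and also serves pairs joined by no
    chain.\<close>
  define D where "D x y = insert 1 (weight ` {ns. (x, y) \<in> chain (topspace X) V ns})" for x y
  define f where "f x y = 1 - Inf (D x y)" for x y
  have bdd: "bdd_below (D x y)" for x y
    unfolding D_def using weight_nonneg by (intro bdd_belowI[of _ 0]) auto
  have ne: "D x y \<noteq> {}" for x y by (simp add: D_def)
  have step: "f x y \<le> f x z + (1/2) ^ n" if "(y, z) \<in> V n" for x y z n
  proof -
    have "Inf (D x z) - (1/2) ^ n \<le> Inf (D x y)"
    proof (rule cInf_greatest[OF ne])
      fix s assume "s \<in> D x y"
      then consider "s = 1" | ns where "s = weight ns" "(x, y) \<in> chain (topspace X) V ns"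
        by (auto simp: D_def)
      then show "Inf (D x z) - (1/2) ^ n \<le> s"
      proof cases
        case 1
        have "Inf (D x z) \<le> 1" by (rule cInf_lower[OF _ bdd]) (simp add: D_def)
        then show ?thesis using 1 zero_le_power[of "1/2::real" n] by linarith
      next
        case (2 ns)
        have "(y, z) \<in> chain (topspace X) V [n]" using that VX(2)[of n] by auto
        then have "(x, z) \<in> chain (topspace X) V (ns @ [n])"
          using 2(2) unfolding chain_append[OF VX(2)] by blast
        then have "weight (ns @ [n]) \<in> D x z" unfolding D_def by (intro insertI2 imageI CollectI)
        then have "Inf (D x z) \<le> weight (ns @ [n])" by (rule cInf_lower) (rule bdd)
        then show ?thesis using 2(1) by simp
      qed
    qed
    then show ?thesis by (simp add: f_def)
  qed
  show ?thesis
  proof (rule that[of f])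
    show "0 \<le> f x y" for x y
      using cInf_lower[OF _ bdd[of x y], of 1] by (simp add: f_def D_def)
    show "f x y \<le> 1" for x y
      using cInf_greatest[OF ne[of x y], of 0] weight_nonneg by (force simp: f_def D_def)
    show "0 < f x x" if "x \<in> topspace X" for x
    proof -
      have "weight [] \<in> D x x" unfolding D_def using that by (intro insertI2 imageI) auto
      then have "Inf (D x x) \<le> weight []" by (rule cInf_lower) (rule bdd)
      then show ?thesis by (simp add: f_def)
    qed
    show "(x, y) \<in> U" if "0 < f x y" for x y
    proof -
      have "Inf (D x y) < 1" using that by (simp add: f_def)
      then obtain s where "s \<in> D x y" "s < 1" using cInf_lessD[OF ne] by blast
      then obtain ns where ns: "weight ns < 1" "(x, y) \<in> chain (topspace X) V ns"
        by (auto simp: D_def)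
      then have "chain (topspace X) V ns \<subseteq> V 0"
        by (intro chain_subset_entourage[where U = V, OF VX(2) VX(1) V(3)]) simp
      then show ?thesis using ns V(4) by blast
    qed
    show "\<exists>W. openin X W \<and> y \<in> W \<and> (\<forall>z\<in>W. \<forall>x. \<bar>f x y - f x z\<bar> \<le> e)"
      if y: "y \<in> topspace X" and e: "0 < e" for y e
    proof -
      obtain n where n: "(1/2::real) ^ n < e" using real_arch_pow_inv[OF e, of "1/2"] by auto
      obtain W where W: "openin X W" "y \<in> W" "W \<subseteq> V n `` {y}"
        using compatible_uniformity_neighbourhood[OF c V(1)[of n] y] by blast
      have "\<bar>f x y - f x z\<bar> \<le> e" if "z \<in> W" for x z
      proof -
        have "(y, z) \<in> V n" using W that by blast
        moreover have "(z, y) \<in> V n" using \<open>(y, z) \<in> V n\<close> V(2)[of n] by blast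
        ultimately show ?thesis using step[of y z n x] step[of z y n x] n by linarith
      qed
      then show ?thesis using W by blast
    qed
  qed
qed

section \<open>Locally finite covers from equicontinuous families\<close>

lemma continuous_map_real_locally:
  assumes "\<And>y e. y \<in> topspace X \<Longrightarrow> 0 < e \<Longrightarrow> \<exists>W. openin X W \<and> y \<in> W \<and> (\<forall>z\<in>W. \<bar>h y - h z\<bar> \<le> e)"
  shows "continuous_map X euclideanreal h"
  unfolding continuous_map_def
proof (intro conjI allI impI)
  fix A :: "real set" assume "openin euclidean A"
  then have A: "open A" by simp
  show "openin X {x\<in>topspace X. h x \<in> A}"
  proof (subst openin_subopen, intro ballI)
    fix y assume "y \<in> {x\<in>topspace X. h x \<in> A}"
    then have y: "y \<in> topspace X" "h y \<in> A" by auto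
    then obtain e where e: "0 < e" "ball (h y) e \<subseteq> A" using A open_contains_ball by blast
    obtain W where W: "openin X W" "y \<in> W" "\<forall>z\<in>W. \<bar>h y - h z\<bar> \<le> e / 2"
      using assms[OF y(1), of "e / 2"] e by auto
    have "W \<subseteq> {x\<in>topspace X. h x \<in> A}"
    proof
      fix z assume z: "z \<in> W"
      then have "h z \<in> ball (h y) e" using W(3) e(1) by (force simp: dist_real_def)
      then show "z \<in> {x\<in>topspace X. h x \<in> A}" using e z openin_subset[OF W(1)] by blast
    qed
    then show "\<exists>T. openin X T \<and> y \<in> T \<and> T \<subseteq> {x\<in>topspace X. h x \<in> A}" using W by blast
  qed
qed simp

text \<open>Replaces Stone's theorem: for an equicontinuous family, the increments of the running suprema
  along a well-order that are at least a fixed fraction of the largest one are locally finitely many.\<close>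
lemma clfn_cover_equicontinuous:
  fixes f :: "'i \<Rightarrow> 'a \<Rightarrow> real"
  assumes f0: "\<And>i y. 0 \<le> f i y" and f1: "\<And>i y. f i y \<le> 1"
    and pos: "\<And>y. y \<in> topspace X \<Longrightarrow> \<exists>i. 0 < f i y"
    and equi: "\<And>y e. y \<in> topspace X \<Longrightarrow> 0 < e \<Longrightarrow>
                 \<exists>W. openin X W \<and> y \<in> W \<and> (\<forall>z\<in>W. \<forall>i. \<bar>f i y - f i z\<bar> \<le> e)"
  shows "\<exists>\<beta>. clfn_cover X \<beta> \<and> (\<forall>B\<in>\<beta>. \<exists>i. B \<subseteq> {y. 0 < f i y})"
proof -
  obtain lt :: "'i \<Rightarrow> 'i \<Rightarrow> bool" where lt: "wfp lt" "transp lt" "asymp lt" "totalp lt"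
    by (rule exists_wellorder)
  define h where "h y i = increment lt (\<lambda>i. f i y) i" for y i
  \<comment> \<open>The largest increment is positive at every point but may come arbitrarily close
    to 0 over \<open>X\<close>, so a threshold for the increments has to be relative to it.\<close>
  define m where "m y = Sup (insert 0 (h y ` UNIV))" for y
  have h0: "0 \<le> h y i" and hf: "h y i \<le> f i y" for y i
    unfolding h_def by (rule increment_nonneg, rule increment_le[OF f0 f1])
  have h1: "h y i \<le> 1" for y i using hf[of y i] f1[of i y] by linarith
  have hm: "h y i \<le> m y" for y i
    unfolding m_def by (rule Sup_insert_upper(2)[of "h y" 1]) (auto simp: h1)
  have mpos: "0 < m y" if y: "y \<in> topspace X" for y
  proof -
    obtain i where "0 < f i y" using pos[OF y] by blast
    then obtain j where "0 < h y j"
      unfolding h_def using increment_pos_exists[OF lt(1), of "\<lambda>i. f i y"] f0 by blast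
    then show ?thesis using hm[of y j] by linarith
  qed
  have near: "\<exists>W. openin X W \<and> y \<in> W \<and> (\<forall>z\<in>W. (\<forall>i. \<bar>h y i - h z i\<bar> \<le> e) \<and> \<bar>m y - m z\<bar> \<le> e)"
    if y: "y \<in> topspace X" and e: "0 < e" for y e
  proof -
    have "0 < e / 2" using e by simp
    from equi[OF y this] obtain W where
      W: "openin X W" "y \<in> W" "\<forall>z\<in>W. \<forall>i. \<bar>f i y - f i z\<bar> \<le> e / 2" by blast
    have hh: "\<bar>h y i - h z i\<bar> \<le> e" if "z \<in> W" for z i
      using increment_perturb[of "\<lambda>i. f i y" 1 "\<lambda>i. f i z" "e/2" lt i] W(3) that f1
      by (simp add: h_def)
    have "\<bar>m y - m z\<bar> \<le> e" if "z \<in> W" for z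
    proof -
      have "h y i \<le> h z i + e" "h z i \<le> h y i + e" for i using hh[OF that, of i] by linarith+
      then have "m y \<le> m z + e" "m z \<le> m y + e"
        unfolding m_def using e h1 by (meson Sup_perturb less_imp_le)+
      then show ?thesis by linarith
    qed
    then show ?thesis using W hh by blast
  qed
  \<comment> \<open>Scaled so that level 0 means a quarter of the largest increment and level 1
    means half of it.\<close>
  define g where "g i y = 4 * (h y i / m y) - 1" for i y
  have g_ge: "0 \<le> g i y \<longleftrightarrow> m y / 4 \<le> h y i" if "y \<in> topspace X" for i y
    using mpos[OF that] by (auto simp: g_def field_simps)
  have "clfn_cover X ((\<lambda>i. {y\<in>topspace X. 0 \<le> g i y}) ` UNIV)"
  proof (rule clfn_cover_superlevel)
    fix i :: 'i
    have "continuous_map X euclideanreal (\<lambda>y. h y i)"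
      by (rule continuous_map_real_locally) (use near in meson)
    moreover have "continuous_map X euclideanreal m"
      by (rule continuous_map_real_locally) (use near in meson)
    ultimately have "continuous_map X euclideanreal (\<lambda>y. h y i / m y)"
      using mpos by (intro continuous_map_real_divide) force+
    then show "continuous_map X euclideanreal (g i)"
      unfolding g_def by (intro continuous_map_diff continuous_map_real_mult_left) auto
  next
    fix y assume y: "y \<in> topspace X"
    \<comment> \<open>If \<open>h z i\<close> is at least a quarter of \<open>m z\<close> and both
      change by at most \<open>e\<close> on \<open>W\<close>, then \<open>h y i\<close> is at least
      \<open>15 * e / 4 - e\<close>, which is above \<open>e\<close>.\<close>
    define e where "e = m y / 16"
    have e: "0 < e" using mpos[OF y] by (simp add: e_def)
    obtain W where W: "openin X W" "y \<in> W"
        "\<And>z. z \<in> W \<Longrightarrow> (\<forall>i. \<bar>h y i - h z i\<bar> \<le> e) \<and> \<bar>m y - m z\<bar> \<le> e"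
      using near[OF y e] by blast
    have "{i\<in>UNIV. \<exists>z\<in>W. 0 \<le> g i z} \<subseteq> {i. e \<le> increment lt (\<lambda>i. f i y) i}"
    proof clarify
      fix i z assume z: "z \<in> W" "0 \<le> g i z"
      have "z \<in> topspace X" using z W(1) openin_subset by blast
      then have "m z / 4 \<le> h z i" using g_ge z by blast
      moreover have "\<bar>h y i - h z i\<bar> \<le> e" "\<bar>m y - m z\<bar> \<le> e" using W(3)[OF z(1)] by auto
      moreover have "m y = 16 * e" by (simp add: e_def)
      ultimately have "e \<le> h y i" using e by linarith
      then show "e \<le> increment lt (\<lambda>i. f i y) i" by (simp add: h_def)
    qed
    moreover have "finite {i. e \<le> increment lt (\<lambda>i. f i y) i}"
      by (rule finite_increment_ge[OF lt(2-4) f1 e])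
    ultimately have "finite {i\<in>UNIV. \<exists>z\<in>W. 0 \<le> g i z}" by (rule finite_subset)
    then show "\<exists>W. openin X W \<and> y \<in> W \<and> finite {i\<in>UNIV. \<exists>z\<in>W. 0 \<le> g i z}"
      using W(1,2) by (intro exI conjI)
    have "m y / 2 < m y" using mpos[OF y] by simp
    then obtain s where s: "s \<in> insert 0 (h y ` UNIV)" "m y / 2 < s"
      using less_cSupD[of "insert 0 (h y ` UNIV)" "m y / 2"] unfolding m_def[symmetric] by blast
    then have "s \<noteq> 0" using mpos[OF y] by linarith
    with s obtain i where "m y / 2 < h y i" by blast
    then show "\<exists>i\<in>UNIV. 1 < g i y" using mpos[OF y] by (auto simp: g_def field_simps intro!: exI[of _ i])
  qed
  moreover have "{y\<in>topspace X. 0 \<le> g i y} \<subseteq> {y. 0 < f i y}" for i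
  proof clarify
    fix y assume y: "y \<in> topspace X" "0 \<le> g i y"
    then have "m y / 4 \<le> h y i" using g_ge by blast
    then show "0 < f i y" using mpos[OF y(1)] hf[of y i] by linarith
  qed
  then have "\<forall>B\<in>(\<lambda>i. {y\<in>topspace X. 0 \<le> g i y}) ` UNIV. \<exists>i. B \<subseteq> {y. 0 < f i y}" by blast
  ultimately show ?thesis by (intro exI conjI)
qed

text \<open>All points of a member are \<open>V\<close>-close to one centre, so any two of them are
  two \<open>V\<close>-steps apart; a diagonal step pads this to the threefold composite.\<close>

lemma clfn_cover_small:
  assumes c: "compatible_uniformity X \<U>" and U: "U \<in> \<U>"
  shows "\<exists>\<beta>. clfn_cover X \<beta> \<and> (\<forall>B\<in>\<beta>. B \<times> B \<subseteq> U)"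
proof -
  have u: "uniformity_on (topspace X) \<U>" using c by (simp add: compatible_uniformity_def)
  obtain V where V: "V \<in> \<U>" "converse V = V" "V O V O V \<subseteq> U"
    using uniformity_on_symmetric_third[OF u U] by blast
  have VX: "Id_on (topspace X) \<subseteq> V" "V \<subseteq> topspace X \<times> topspace X"
    using uniformity_on_subset[OF u V(1)] .
  obtain f :: "'a \<Rightarrow> 'a \<Rightarrow> real" where f:
    "\<And>x y. 0 \<le> f x y" "\<And>x y. f x y \<le> 1" "\<And>x. x \<in> topspace X \<Longrightarrow> 0 < f x x"
    "\<And>x y. 0 < f x y \<Longrightarrow> (x, y) \<in> V"
    "\<And>y e. y \<in> topspace X \<Longrightarrow> 0 < e \<Longrightarrow> \<exists>W. openin X W \<and> y \<in> W \<and> (\<forall>z\<in>W. \<forall>x. \<bar>f x y - f x z\<bar> \<le> e)"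
    by (rule entourage_equicontinuous_family[OF V(1) c]) (rule that)
  obtain \<beta> where \<beta>: "clfn_cover X \<beta>" "\<forall>B\<in>\<beta>. \<exists>x. B \<subseteq> {y. 0 < f x y}"
    using clfn_cover_equicontinuous[of f X, OF f(1,2) _ f(5)] f(3) by blast
  have "B \<times> B \<subseteq> U" if B: "B \<in> \<beta>" for B
  proof clarify
    fix y z assume yz: "y \<in> B" "z \<in> B"
    obtain x where "B \<subseteq> {y. 0 < f x y}" using \<beta>(2) B by blast
    then have "(x, y) \<in> V" "(x, z) \<in> V" using yz f(4) by blast+
    moreover have "(y, x) \<in> V" using \<open>(x, y) \<in> V\<close> V(2) by blast
    moreover have "(z, z) \<in> V" using \<open>(x, z) \<in> V\<close> VX by blast
    ultimately show "(y, z) \<in> U" using V(3) by blast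
  qed
  then show ?thesis using \<beta>(1) by blast
qed

section \<open>The cell structure of a cofinal family\<close>

lemma openin_product_discrete_cylinder:
  assumes "finite l" "l \<subseteq> A" "w \<in> PiE A K"
  shows "openin (product_topology (\<lambda>i. discrete_topology (K i)) A) {w'\<in>PiE A K. \<forall>i\<in>l. w' i = w i}"
  using assms(1,2)
proof (induction l rule: finite_induct)
  case empty
  have "openin (product_topology (\<lambda>i. discrete_topology (K i)) A) (PiE A K)"
    using openin_topspace[of "product_topology (\<lambda>i. discrete_topology (K i)) A"] by simp
  then show ?case by simp
next
  case (insert i l)
  have "i \<in> A" using insert.prems by simp
  then have "openin (product_topology (\<lambda>i. discrete_topology (K i)) A)
      {w'\<in>topspace (product_topology (\<lambda>i. discrete_topology (K i)) A). w' i \<in> {w i}}"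
    using assms(3) by (intro openin_continuous_map_preimage[OF continuous_map_product_projection]) auto
  moreover have "{w'\<in>PiE A K. \<forall>i\<in>insert i l. w' i = w i} =
      {w'\<in>topspace (product_topology (\<lambda>i. discrete_topology (K i)) A). w' i \<in> {w i}} \<inter> {w'\<in>PiE A K. \<forall>i\<in>l. w' i = w i}"
    by auto
  moreover have "openin (product_topology (\<lambda>i. discrete_topology (K i)) A) {w'\<in>PiE A K. \<forall>i\<in>l. w' i = w i}"
    using insert by blast
  ultimately show ?case by (simp only: openin_Int)
qed

text \<open>A condition on finitely many coordinates is clopen in a product of discrete spaces, and
  a product of finite ones is compact. By monotonicity, a choice good on the union of finitely many
  index sets is good on each of them, which is the finite intersection property.\<close>

lemma finite_choice_compactness:
  fixes K :: "'i \<Rightarrow> 'v set" and P :: "'i set \<Rightarrow> ('i \<Rightarrow> 'v) \<Rightarrow> bool"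
  assumes fin: "\<And>i. i \<in> A \<Longrightarrow> finite (K i)"
    and local: "\<And>l w w'. finite l \<Longrightarrow> l \<subseteq> A \<Longrightarrow> \<forall>i\<in>l. w' i = w i \<Longrightarrow> P l w \<Longrightarrow> P l w'"
    and mono: "\<And>l m w. finite m \<Longrightarrow> m \<subseteq> A \<Longrightarrow> l \<subseteq> m \<Longrightarrow> P m w \<Longrightarrow> P l w"
    and ex: "\<And>l. finite l \<Longrightarrow> l \<subseteq> A \<Longrightarrow> \<exists>w\<in>PiE A K. P l w"
  shows "\<exists>w\<in>PiE A K. \<forall>l. finite l \<and> l \<subseteq> A \<longrightarrow> P l w"
proof -
  let ?T = "product_topology (\<lambda>i. discrete_topology (K i)) A"
  define C where "C l = {w\<in>PiE A K. P l w}" for l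
  define \<L> where "\<L> = {l. finite l \<and> l \<subseteq> A}"
  have top: "topspace ?T = PiE A K" by simp
  have comp: "compact_space ?T"
    using fin by (simp add: compact_space_product_topology compact_space_discrete_topology)
  have open_local: "openin ?T {w\<in>PiE A K. Q w}"
    if l: "finite l" "l \<subseteq> A" and Q: "\<And>w w'. \<forall>i\<in>l. w' i = w i \<Longrightarrow> Q w \<Longrightarrow> Q w'" for l Q
  proof (subst openin_subopen, intro ballI)
    fix w assume w: "w \<in> {w\<in>PiE A K. Q w}"
    then have "openin ?T {w'\<in>PiE A K. \<forall>i\<in>l. w' i = w i}"
      using l by (intro openin_product_discrete_cylinder) auto
    moreover have "{w'\<in>PiE A K. \<forall>i\<in>l. w' i = w i} \<subseteq> {w\<in>PiE A K. Q w}" using w Q by blast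
    ultimately show "\<exists>T. openin ?T T \<and> w \<in> T \<and> T \<subseteq> {w\<in>PiE A K. Q w}" using w by blast
  qed
  have closed: "closedin ?T (C l)" if "l \<in> \<L>" for l
  proof -
    have l: "finite l" "l \<subseteq> A" using that by (auto simp: \<L>_def)
    have "openin ?T {w\<in>PiE A K. \<not> P l w}"
    proof (rule open_local[OF l])
      fix w w' assume "\<forall>i\<in>l. w' i = w i" "\<not> P l w"
      then show "\<not> P l w'" using local[OF l, of w w'] by metis
    qed
    moreover have "topspace ?T - C l = {w\<in>PiE A K. \<not> P l w}" unfolding top C_def by blast
    ultimately show ?thesis unfolding closedin_def top by (auto simp: C_def)
  qed
  have "\<Inter>\<F> \<noteq> {}" if F: "finite \<F>" "\<F> \<subseteq> C ` \<L>" for \<F>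
  proof -
    obtain L where L: "L \<subseteq> \<L>" "finite L" "\<F> = C ` L" using F finite_subset_image by metis
    have U: "finite (\<Union>L)" "\<Union>L \<subseteq> A" using L by (auto simp: \<L>_def)
    from ex[OF this] obtain w where w: "w \<in> PiE A K" "P (\<Union>L) w" ..
    have "w \<in> C l" if "l \<in> L" for l
      using w mono[OF U Union_upper[OF that] w(2)] by (simp add: C_def)
    then show ?thesis using L(3) by blast
  qed
  then have "\<Inter>(C ` \<L>) \<noteq> {}"
    using comp[unfolded compact_space_fip, rule_format, of "C ` \<L>"] closed by blast
  then obtain w where w: "\<And>l. l \<in> \<L> \<Longrightarrow> w \<in> C l" by blast
  have "{} \<in> \<L>" by (simp add: \<L>_def)
  then show ?thesis using w by (intro bexI[of _ w]) (auto simp: C_def \<L>_def)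
qed

section \<open>Local behaviour of the covers\<close>

locale complete_cofinal =
  fixes X :: "'a topology" and \<A> :: "'a set set set" and \<U> :: "'a rel set"
  assumes tych: "tychonoff_space X" and cofinal: "cofinal_clfn X \<A>"
    and compat: "compatible_uniformity X \<U>" and complete: "complete_wrt X \<U>"
begin

abbreviation \<Lambda> where "\<Lambda> \<equiv> Lam \<A>"
abbreviation F where "F \<equiv> inv_limit (Lam \<A>) (\<subseteq>) (N0 X) pi0"
abbreviation pt where "pt \<equiv> pi_point X \<A>"

lemma cover: "\<alpha> \<in> \<A> \<Longrightarrow> clfn_cover X \<alpha>"
  using cofinal by (simp add: cofinal_clfn_def)

lemma refinement: "clfn_cover X \<beta> \<Longrightarrow> \<exists>\<alpha>\<in>\<A>. refines \<alpha> \<beta>"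
  using cofinal by (simp add: cofinal_clfn_def)

lemma cover_facts:
  assumes "\<alpha> \<in> \<A>"
  shows "V \<in> \<alpha> \<Longrightarrow> closedin X V" "\<Union>\<alpha> = topspace X" "locally_finite_in X \<alpha>"
  using cover[OF assms] by (simp_all add: clfn_cover_def)

lemma Lam_simps:
  "l \<in> \<Lambda> \<Longrightarrow> finite l" "l \<in> \<Lambda> \<Longrightarrow> \<alpha> \<in> l \<Longrightarrow> \<alpha> \<in> \<A>" "{} \<in> \<Lambda>" "\<alpha> \<in> \<A> \<Longrightarrow> {\<alpha>} \<in> \<Lambda>"
  "l \<in> \<Lambda> \<Longrightarrow> m \<in> \<Lambda> \<Longrightarrow> l \<union> m \<in> \<Lambda>"
  by (auto simp: Lam_def)

lemma finite_members:
  assumes "\<alpha> \<in> \<A>" "x \<in> topspace X"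
  shows "finite {V\<in>\<alpha>. x \<in> V}"
proof -
  obtain W where W: "x \<in> W" "finite {V\<in>\<alpha>. V \<inter> W \<noteq> {}}"
    using cover_facts(3)[OF assms(1)] assms(2) unfolding locally_finite_in_def by blast
  show ?thesis by (rule finite_subset[OF _ W(2)]) (use W(1) in blast)
qed

text \<open>Near \<open>x\<close> only finitely many members occur, so those missing
  \<open>x\<close> have a closed union, which can be removed.\<close>

lemma neighbourhood_one:
  assumes a: "\<alpha> \<in> \<A>" and x: "x \<in> topspace X"
  shows "\<exists>W. openin X W \<and> x \<in> W \<and> (\<forall>V\<in>\<alpha>. V \<inter> W \<noteq> {} \<longrightarrow> x \<in> V)"
proof -
  obtain W where W: "openin X W" "x \<in> W" "finite {V\<in>\<alpha>. V \<inter> W \<noteq> {}}"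
    using cover_facts(3)[OF a] x unfolding locally_finite_in_def by blast
  let ?B = "{V\<in>\<alpha>. V \<inter> W \<noteq> {} \<and> x \<notin> V}"
  have "finite ?B" by (rule finite_subset[OF _ W(3)]) blast
  then have "closedin X (\<Union>?B)" using cover_facts(1)[OF a] by (intro closedin_Union) auto
  then have "openin X (W - \<Union>?B)" using W(1) by (rule openin_diff[rotated])
  then show ?thesis using W(2) by (intro exI[of _ "W - \<Union>?B"]) blast
qed

lemma neighbourhood:
  assumes l: "l \<in> \<Lambda>" and x: "x \<in> topspace X"
  shows "\<exists>W. openin X W \<and> x \<in> W \<and> (\<forall>\<alpha>\<in>l. \<forall>V\<in>\<alpha>. V \<inter> W \<noteq> {} \<longrightarrow> x \<in> V)"
proof -
  obtain W where W: "\<And>\<alpha>. \<alpha> \<in> l \<Longrightarrow> openin X (W \<alpha>) \<and> x \<in> W \<alpha> \<and> (\<forall>V\<in>\<alpha>. V \<inter> W \<alpha> \<noteq> {} \<longrightarrow> x \<in> V)"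
    using neighbourhood_one[OF Lam_simps(2)[OF l] x] by metis
  let ?W = "topspace X \<inter> (\<Inter>\<alpha>\<in>l. W \<alpha>)"
  have "openin X ?W"
  proof (cases "l = {}")
    case False
    then have "openin X (\<Inter>(W ` l))" using Lam_simps(1)[OF l] W by (intro openin_Inter) auto
    then show ?thesis by (rule openin_Int[OF openin_topspace])
  qed simp
  moreover have "x \<in> ?W" using W x by blast
  moreover have "\<forall>\<alpha>\<in>l. \<forall>V\<in>\<alpha>. V \<inter> ?W \<noteq> {} \<longrightarrow> x \<in> V" using W by blast
  ultimately show ?thesis by blast
qed

text \<open>Each cover has its own gap in the values of a function that is 0 at \<open>x\<close> and
  1 off \<open>W\<close>, and each gap absorbs one passage from a set to one that meets it.\<close>

lemma two_step_separation:
  assumes W: "openin X W" and x: "x \<in> W"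
  shows "\<exists>\<beta>1\<in>\<A>. \<exists>\<beta>2\<in>\<A>. \<forall>V\<in>\<beta>1. \<forall>V'\<in>\<beta>2. x \<in> V \<longrightarrow> V \<inter> V' \<noteq> {} \<longrightarrow> V' \<subseteq> W"
proof -
  obtain f where f: "continuous_map X euclideanreal f" "f x = (0::real)" "f ` (topspace X - W) \<subseteq> {1}"
    using tych W x unfolding tychonoff_space_def completely_regular_space_alt' by blast
  \<comment> \<open>Only the order 0 < 1/8 < 1/4 < 1/2 < 3/4 < 1 matters: a set through
    \<open>x\<close> stays at or below 1/4, and a set meeting it at or below 3/4.\<close>
  let ?c = "\<lambda>a b. {{x\<in>topspace X. a \<le> f x}, {x\<in>topspace X. f x \<le> b}}"
  obtain \<beta>1 where b1: "\<beta>1 \<in> \<A>" "refines \<beta>1 (?c (1/8) (1/4))"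
    using refinement[OF clfn_cover_two_sets[OF f(1), of "1/8" "1/4"]] by auto
  obtain \<beta>2 where b2: "\<beta>2 \<in> \<A>" "refines \<beta>2 (?c (1/2) (3/4))"
    using refinement[OF clfn_cover_two_sets[OF f(1), of "1/2" "3/4"]] by auto
  have "V' \<subseteq> W" if V: "V \<in> \<beta>1" "x \<in> V" and V': "V' \<in> \<beta>2" "V \<inter> V' \<noteq> {}" for V V'
  proof -
    have "V \<subseteq> {x\<in>topspace X. 1/8 \<le> f x} \<or> V \<subseteq> {x\<in>topspace X. f x \<le> 1/4}"
      using b1(2) V(1) unfolding refines_def by blast
    then have 1: "V \<subseteq> {x\<in>topspace X. f x \<le> 1/4}" using V(2) f(2) by auto
    have "V' \<subseteq> {x\<in>topspace X. 1/2 \<le> f x} \<or> V' \<subseteq> {x\<in>topspace X. f x \<le> 3/4}"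
      using b2(2) V'(1) unfolding refines_def by blast
    then have "V' \<subseteq> {x\<in>topspace X. f x \<le> 3/4}" using 1 V'(2) by force
    then show ?thesis using f(3) by force
  qed
  then show ?thesis using b1(1) b2(1) by blast
qed

section \<open>Vertices, adjacency and stars\<close>

lemma N0_mem: "a \<in> N0 X m \<Longrightarrow> \<alpha> \<in> m \<Longrightarrow> a \<alpha> \<in> \<alpha>"
  by (auto simp: N0_def)

lemma N0_wedge: "a \<in> N0 X m \<Longrightarrow> wedge X m a \<noteq> {}"
  by (auto simp: N0_def)

lemma wedge_mono: "l \<subseteq> m \<Longrightarrow> wedge X m a \<subseteq> wedge X l (restrict a l)"
  by (auto simp: wedge_def)

lemma restrict_N0: "l \<subseteq> m \<Longrightarrow> a \<in> N0 X m \<Longrightarrow> restrict a l \<in> N0 X l"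
  using wedge_mono[of l m a] unfolding N0_def by auto

lemma r0_refl: "a \<in> N0 X l \<Longrightarrow> (a, a) \<in> r0 X l"
  using N0_wedge by (auto simp: r0_def)

lemma r0_sym: "(a, b) \<in> r0 X l \<Longrightarrow> (b, a) \<in> r0 X l"
  by (auto simp: r0_def)

lemma r0_common: "a \<in> N0 X l \<Longrightarrow> b \<in> N0 X l \<Longrightarrow> x \<in> wedge X l a \<Longrightarrow> x \<in> wedge X l b \<Longrightarrow> (a, b) \<in> r0 X l"
  by (auto simp: r0_def)

lemma r0_N0: "(a, b) \<in> r0 X l \<Longrightarrow> a \<in> N0 X l \<and> b \<in> N0 X l"
  by (auto simp: r0_def)

lemma r0_meet: "(a, b) \<in> r0 X m \<Longrightarrow> \<alpha> \<in> m \<Longrightarrow> \<beta> \<in> m \<Longrightarrow> a \<alpha> \<inter> b \<beta> \<noteq> {}"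
  by (auto simp: r0_def wedge_def)

text \<open>Adjacent vertices share a point, so every coordinate of one meets every coordinate of
  the other, even for different covers. Thus \<open>a \<beta>1\<close> contains \<open>x\<close> and
  forces \<open>b \<beta>2\<close> into \<open>W\<close>; then \<open>c \<alpha>\<close> meets
  \<open>W\<close> and must contain \<open>x\<close>.\<close>

lemma star_control:
  assumes l: "l \<in> \<Lambda>" and x: "x \<in> topspace X"
  shows "\<exists>m\<in>\<Lambda>. l \<subseteq> m \<and> (\<forall>a b c. x \<in> wedge X m a \<longrightarrow> (a, b) \<in> r0 X m \<longrightarrow> (b, c) \<in> r0 X m
           \<longrightarrow> (\<forall>\<alpha>\<in>l. x \<in> c \<alpha>))"
proof -
  obtain W where W: "openin X W" "x \<in> W" "\<forall>\<alpha>\<in>l. \<forall>V\<in>\<alpha>. V \<inter> W \<noteq> {} \<longrightarrow> x \<in> V"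
    using neighbourhood[OF l x] by blast
  obtain \<beta>1 \<beta>2 where b: "\<beta>1 \<in> \<A>" "\<beta>2 \<in> \<A>"
    "\<And>V V'. V \<in> \<beta>1 \<Longrightarrow> V' \<in> \<beta>2 \<Longrightarrow> x \<in> V \<Longrightarrow> V \<inter> V' \<noteq> {} \<Longrightarrow> V' \<subseteq> W"
    using two_step_separation[OF W(1,2)] by metis
  let ?m = "l \<union> ({\<beta>1} \<union> {\<beta>2})"
  have "?m \<in> \<Lambda>" by (intro Lam_simps l b)
  moreover have "x \<in> c \<alpha>"
    if "x \<in> wedge X ?m a" "(a, b) \<in> r0 X ?m" "(b, c) \<in> r0 X ?m" "\<alpha> \<in> l" for a b c \<alpha>
  proof -
    have "x \<in> a \<beta>1" using that(1) by (simp add: wedge_def)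
    moreover have "a \<beta>1 \<in> \<beta>1" "b \<beta>2 \<in> \<beta>2" "c \<alpha> \<in> \<alpha>"
      using r0_N0[OF that(2)] r0_N0[OF that(3)] that(4) N0_mem[of _ ?m] by auto
    moreover have "a \<beta>1 \<inter> b \<beta>2 \<noteq> {}" "b \<beta>2 \<inter> c \<alpha> \<noteq> {}"
      using r0_meet[OF that(2), of \<beta>1 \<beta>2] r0_meet[OF that(3), of \<beta>2 \<alpha>] that(4) by auto
    ultimately have "b \<beta>2 \<subseteq> W" by (intro b(3))
    then have "c \<alpha> \<inter> W \<noteq> {}" using \<open>b \<beta>2 \<inter> c \<alpha> \<noteq> {}\<close> by blast
    then show ?thesis using W(3) that(4) \<open>c \<alpha> \<in> \<alpha>\<close> by blast
  qed
  ultimately show ?thesis by (intro bexI[of _ ?m]) blast+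
qed

lemma inverse_system: "inverse_system_graphs \<Lambda> (\<subseteq>) (N0 X) (r0 X) pi0"
  unfolding inverse_system_graphs_def
proof (intro conjI ballI allI impI)
  show "directed_set \<Lambda> (\<subseteq>)"
    unfolding directed_set_def
  proof (intro conjI ballI)
    show "\<Lambda> \<noteq> {}" using Lam_simps(3) by blast
    show "\<exists>c\<in>\<Lambda>. a \<subseteq> c \<and> b \<subseteq> c" if "a \<in> \<Lambda>" "b \<in> \<Lambda>" for a b
      using Lam_simps(5)[OF that] by (intro bexI[of _ "a \<union> b"]) auto
  qed auto
  show "r0 X l \<subseteq> N0 X l \<times> N0 X l" for l using r0_N0 by (intro subrelI) simp
  show "(a, a) \<in> r0 X l" if "a \<in> N0 X l" for a l using r0_refl[OF that] .
  show "sym (r0 X l)" for l using r0_sym by (auto intro: symI)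
  show "pi0 l l a = a" if "a \<in> N0 X l" for a l
    using that by (auto simp: pi0_def N0_def PiE_restrict)
  show "pi0 m l ` N0 X m \<subseteq> N0 X l" if "l \<subseteq> m" for l m
    using restrict_N0[OF that] by (auto simp: pi0_def)
  show "pi0 m l (pi0 n m a) = pi0 n l a" if "l \<subseteq> m \<and> m \<subseteq> n" for l m n a
    using that by (auto simp: pi0_def restrict_def fun_eq_iff)
  show "(pi0 m l a, pi0 m l b) \<in> r0 X l" if "l \<subseteq> m" "(a, b) \<in> r0 X m" for l m a b
    using that wedge_mono[OF that(1), of a] wedge_mono[OF that(1), of b] restrict_N0[OF that(1)]
    by (auto simp: pi0_def r0_def)
qed

section \<open>Threads and their points\<close>

lemma F_N0: "z \<in> F \<Longrightarrow> l \<in> \<Lambda> \<Longrightarrow> z l \<in> N0 X l"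
  by (auto simp: inv_limit_def)

lemma F_restrict: "z \<in> F \<Longrightarrow> l \<in> \<Lambda> \<Longrightarrow> m \<in> \<Lambda> \<Longrightarrow> l \<subseteq> m \<Longrightarrow> restrict (z m) l = z l"
  by (auto simp: inv_limit_def pi0_def)

lemma F_component:
  assumes "z \<in> F" "l \<in> \<Lambda>" "\<alpha> \<in> l"
  shows "z l \<alpha> = z {\<alpha>} \<alpha>"
proof -
  have "restrict (z l) {\<alpha>} = z {\<alpha>}"
    using F_restrict[OF assms(1) _ assms(2)] assms Lam_simps(2,4) by blast
  then show ?thesis by (metis restrict_apply' singletonI)
qed

lemma F_wedge_antimono:
  "z \<in> F \<Longrightarrow> l \<in> \<Lambda> \<Longrightarrow> m \<in> \<Lambda> \<Longrightarrow> l \<subseteq> m \<Longrightarrow> wedge X m (z m) \<subseteq> wedge X l (z l)"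
  using wedge_mono[of l m "z m"] F_restrict by metis

lemma wedge_closedin:
  assumes "l \<in> \<Lambda>" "a \<in> N0 X l"
  shows "closedin X (wedge X l a)"
proof (cases "l = {}")
  case False
  have "closedin X (\<Inter>\<alpha>\<in>l. a \<alpha>)"
    using False cover_facts(1)[OF Lam_simps(2)[OF assms(1)]] N0_mem[OF assms(2)]
    by (intro closedin_Inter) auto
  then show ?thesis unfolding wedge_def by (rule closedin_Int[OF closedin_topspace])
qed (simp add: wedge_def)

text \<open>Since \<open>\<Lambda>\<close> is directed, the sets form a filter base, and smallness
  makes the filter Cauchy. It serves both the wedges of a thread and the tails of a Cauchy
  net.\<close>

lemma Cauchy_family_limit:
  assumes ne: "\<And>l. l \<in> \<Lambda> \<Longrightarrow> B l \<noteq> {}" and top: "\<And>l. l \<in> \<Lambda> \<Longrightarrow> B l \<subseteq> topspace X"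
    and anti: "\<And>l m. l \<in> \<Lambda> \<Longrightarrow> m \<in> \<Lambda> \<Longrightarrow> l \<subseteq> m \<Longrightarrow> B m \<subseteq> B l"
    and small: "\<And>U. U \<in> \<U> \<Longrightarrow> \<exists>l\<in>\<Lambda>. B l \<times> B l \<subseteq> U"
  shows "\<exists>x\<in>topspace X. \<forall>W. openin X W \<and> x \<in> W \<longrightarrow> (\<exists>l\<in>\<Lambda>. B l \<subseteq> W)"
proof -
  define G where "G = (INF l\<in>\<Lambda>. principal (B l))"
  have ev: "eventually P G \<longleftrightarrow> (\<exists>l\<in>\<Lambda>. \<forall>x\<in>B l. P x)" for P
    unfolding G_def
  proof (subst eventually_INF_base)
    show "\<Lambda> \<noteq> {}" using Lam_simps(3) by blast
    show "\<exists>c\<in>\<Lambda>. principal (B c) \<le> inf (principal (B a)) (principal (B b))" if "a \<in> \<Lambda>" "b \<in> \<Lambda>" for a b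
      using Lam_simps(5)[OF that] anti[of a "a \<union> b"] anti[of b "a \<union> b"] that
      by (intro bexI[of _ "a \<union> b"]) auto
  qed (simp add: eventually_principal)
  have "cauchy_filter_unif (topspace X) \<U> G"
    unfolding cauchy_filter_unif_def
  proof (intro conjI ballI)
    show "G \<noteq> bot" unfolding trivial_limit_def ev using ne by blast
    show "eventually (\<lambda>x. x \<in> topspace X) G" unfolding ev using top Lam_simps(3) by blast
    fix U assume "U \<in> \<U>"
    then obtain l where l: "l \<in> \<Lambda>" "B l \<times> B l \<subseteq> U" using small by blast
    then show "\<exists>A. eventually (\<lambda>x. x \<in> A) G \<and> A \<times> A \<subseteq> U"
      unfolding ev by (intro exI[of _ "B l"]) blast
  qed
  then obtain x where x: "limitin X id x G" using complete unfolding complete_wrt_def by blast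
  then have "x \<in> topspace X" "\<And>W. openin X W \<and> x \<in> W \<Longrightarrow> \<exists>l\<in>\<Lambda>. B l \<subseteq> W"
    unfolding limitin_def ev by (simp_all add: subset_eq)
  then show ?thesis by blast
qed

lemma small_member:
  assumes "U \<in> \<U>"
  shows "\<exists>\<alpha>\<in>\<A>. \<forall>V\<in>\<alpha>. V \<times> V \<subseteq> U"
proof -
  obtain \<beta> where b: "clfn_cover X \<beta>" "\<forall>B\<in>\<beta>. B \<times> B \<subseteq> U" using clfn_cover_small[OF compat assms] by blast
  obtain \<alpha> where a: "\<alpha> \<in> \<A>" "refines \<alpha> \<beta>" using refinement[OF b(1)] by blast
  have "V \<times> V \<subseteq> U" if V: "V \<in> \<alpha>" for V
  proof -
    obtain B where B: "B \<in> \<beta>" "V \<subseteq> B" using a(2) V unfolding refines_def by blast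
    then have "V \<times> V \<subseteq> B \<times> B" by blast
    then show ?thesis using b(2) B(1) by blast
  qed
  then show ?thesis using a(1) by blast
qed

lemma wedge_single: "wedge X {\<alpha>} a \<subseteq> a \<alpha>"
  by (auto simp: wedge_def)

lemma thread_point_exists:
  assumes z: "z \<in> F"
  shows "\<exists>x. x \<in> (\<Inter>l\<in>\<Lambda>. wedge X l (z l))"
proof -
  have "\<exists>l\<in>\<Lambda>. wedge X l (z l) \<times> wedge X l (z l) \<subseteq> U" if U: "U \<in> \<U>" for U
  proof -
    obtain \<alpha> where a: "\<alpha> \<in> \<A>" "\<forall>V\<in>\<alpha>. V \<times> V \<subseteq> U" using small_member[OF U] by blast
    have l: "{\<alpha>} \<in> \<Lambda>" using a Lam_simps(4) by blast
    then have "z {\<alpha>} \<alpha> \<times> z {\<alpha>} \<alpha> \<subseteq> U" using a(2) N0_mem[OF F_N0[OF z]] by blast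
    then show ?thesis using wedge_single[of \<alpha> "z {\<alpha>}"] l by (intro bexI[of _ "{\<alpha>}"]) blast+
  qed
  then obtain x where x: "x \<in> topspace X"
      "\<And>W. openin X W \<and> x \<in> W \<Longrightarrow> \<exists>l\<in>\<Lambda>. wedge X l (z l) \<subseteq> W"
    using Cauchy_family_limit[of "\<lambda>l. wedge X l (z l)"] N0_wedge[OF F_N0[OF z]] F_wedge_antimono[OF z]
    by (auto simp: wedge_def)
  have "x \<in> wedge X l (z l)" if l: "l \<in> \<Lambda>" for l
  proof (rule ccontr)
    \<comment> \<open>The complement of the closed wedge would be a neighbourhood of the limit and
      contain another wedge, but both wedges contain the nonempty wedge at
      \<open>l \<union> m\<close>.\<close>
    assume "x \<notin> wedge X l (z l)"
    then have "openin X (topspace X - wedge X l (z l)) \<and> x \<in> topspace X - wedge X l (z l)"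
      using wedge_closedin[OF l F_N0[OF z l]] x(1) by blast
    then obtain m where m: "m \<in> \<Lambda>" "wedge X m (z m) \<subseteq> topspace X - wedge X l (z l)" using x(2) by blast
    have lm: "l \<union> m \<in> \<Lambda>" using l m Lam_simps(5) by blast
    have "wedge X (l \<union> m) (z (l \<union> m)) \<subseteq> wedge X l (z l)" "wedge X (l \<union> m) (z (l \<union> m)) \<subseteq> wedge X m (z m)"
      using F_wedge_antimono[OF z _ lm] l m(1) by blast+
    then show False using m(2) N0_wedge[OF F_N0[OF z lm]] by blast
  qed
  then show ?thesis by blast
qed

text \<open>The sets of \<open>z\<close> at \<open>\<beta>1\<close> and \<open>\<beta>2\<close> meet
  in \<open>x\<close>, so the second lies in \<open>W\<close>; it also contains
  \<open>y\<close>.\<close>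

lemma thread_point_unique:
  assumes z: "z \<in> F" and x: "x \<in> (\<Inter>l\<in>\<Lambda>. wedge X l (z l))" and y: "y \<in> (\<Inter>l\<in>\<Lambda>. wedge X l (z l))"
  shows "x = y"
proof (rule ccontr)
  assume "x \<noteq> y"
  have top: "x \<in> topspace X" "y \<in> topspace X" using INT_D[OF x Lam_simps(3)] INT_D[OF y Lam_simps(3)] by (simp_all add: wedge_def)
  then obtain W where W: "openin X W" "x \<in> W" "y \<notin> W"
    using tych \<open>x \<noteq> y\<close> unfolding tychonoff_space_def Hausdorff_space_def by (metis disjnt_iff)
  obtain \<beta>1 \<beta>2 where b: "\<beta>1 \<in> \<A>" "\<beta>2 \<in> \<A>"
    "\<And>V V'. V \<in> \<beta>1 \<Longrightarrow> V' \<in> \<beta>2 \<Longrightarrow> x \<in> V \<Longrightarrow> V \<inter> V' \<noteq> {} \<Longrightarrow> V' \<subseteq> W"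
    using two_step_separation[OF W(1,2)] by metis
  have "x \<in> z {\<beta>1} \<beta>1" "x \<in> z {\<beta>2} \<beta>2" "y \<in> z {\<beta>2} \<beta>2"
    using x y Lam_simps(4)[OF b(1)] Lam_simps(4)[OF b(2)] wedge_single by blast+
  moreover have "z {\<beta>1} \<beta>1 \<in> \<beta>1" "z {\<beta>2} \<beta>2 \<in> \<beta>2"
    using N0_mem[OF F_N0[OF z]] Lam_simps(4) b(1,2) by blast+
  ultimately have "z {\<beta>2} \<beta>2 \<subseteq> W" using b(3) by blast
  then show False using W(3) \<open>y \<in> z {\<beta>2} \<beta>2\<close> by blast
qed

lemma pt_eqI:
  assumes "z \<in> F" "\<And>l. l \<in> \<Lambda> \<Longrightarrow> x \<in> wedge X l (z l)"
  shows "pt z = x"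
  unfolding pi_point_def
  by (rule the_equality) (use assms thread_point_unique[OF assms(1)] in blast)+

lemma pt_wedge:
  assumes "z \<in> F" "l \<in> \<Lambda>"
  shows "pt z \<in> wedge X l (z l)"
proof -
  obtain x where "x \<in> (\<Inter>l\<in>\<Lambda>. wedge X l (z l))" using thread_point_exists[OF assms(1)] by blast
  then show ?thesis using pt_eqI[OF assms(1), of x] assms(2) by blast
qed

lemma pt_topspace: "z \<in> F \<Longrightarrow> pt z \<in> topspace X"
  using pt_wedge[OF _ Lam_simps(3)] by (auto simp: wedge_def)

lemma pt_component: "z \<in> F \<Longrightarrow> l \<in> \<Lambda> \<Longrightarrow> \<alpha> \<in> l \<Longrightarrow> pt z \<in> z l \<alpha>"
  using pt_wedge[of z l] by (auto simp: wedge_def)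

text \<open>A thread amounts to one member chosen from each cover. Restrictions of one choice are
  compatible automatically, and members through a common point keep all wedges nonempty.\<close>

definition thread where "thread w = (\<lambda>l\<in>\<Lambda>. restrict w l)"

lemma thread_in:
  assumes x: "x \<in> topspace X" and w: "\<And>\<alpha>. \<alpha> \<in> \<A> \<Longrightarrow> w \<alpha> \<in> \<alpha> \<and> x \<in> w \<alpha>"
  shows "thread w \<in> F" "pt (thread w) = x"
proof -
  have xw: "x \<in> wedge X l (restrict w l)" if "l \<in> \<Lambda>" for l
    using x w Lam_simps(2)[OF that] by (auto simp: wedge_def)
  have "restrict w l \<in> N0 X l" if "l \<in> \<Lambda>" for l
    using xw[OF that] w Lam_simps(2)[OF that] by (auto simp: N0_def)
  then show F: "thread w \<in> F"
    by (auto simp: inv_limit_def thread_def pi0_def restrict_def fun_eq_iff)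
  show "pt (thread w) = x" by (rule pt_eqI[OF F]) (simp add: thread_def xw)
qed

lemma thread_apply: "l \<in> \<Lambda> \<Longrightarrow> thread w l = restrict w l"
  by (simp add: thread_def)

lemma choice_exists:
  assumes "x \<in> topspace X"
  obtains w where "\<And>\<alpha>. \<alpha> \<in> \<A> \<Longrightarrow> w \<alpha> \<in> \<alpha> \<and> x \<in> w \<alpha>"
proof -
  have "\<forall>\<alpha>\<in>\<A>. \<exists>V. V \<in> \<alpha> \<and> x \<in> V" using cover_facts(2) assms by blast
  then obtain w where "\<forall>\<alpha>\<in>\<A>. w \<alpha> \<in> \<alpha> \<and> x \<in> w \<alpha>" by (rule bchoice[THEN exE])
  then show ?thesis using that by blast
qed

lemma pt_surj:
  assumes "x \<in> topspace X"
  shows "\<exists>z\<in>F. pt z = x"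
proof -
  obtain w where "\<And>\<alpha>. \<alpha> \<in> \<A> \<Longrightarrow> w \<alpha> \<in> \<alpha> \<and> x \<in> w \<alpha>" by (rule choice_exists[OF assms]) (rule that)
  then show ?thesis using thread_in[OF assms, of w] by blast
qed

text \<open>For the direction from equivalence, star control is applied to the step from
  \<open>z m\<close> to \<open>z' m\<close> followed by a stationary step: it puts the point of
  \<open>z\<close> into every set of \<open>z'\<close>.\<close>

lemma equiv_iff_pt_eq:
  assumes z: "z \<in> F" and z': "z' \<in> F"
  shows "thread_equiv \<Lambda> (r0 X) z z' \<longleftrightarrow> pt z = pt z'"
proof
  assume "pt z = pt z'"
  then show "thread_equiv \<Lambda> (r0 X) z z'"
    unfolding thread_equiv_def using pt_wedge[OF z] pt_wedge[OF z'] F_N0[OF z] F_N0[OF z']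
    by (metis r0_common)
next
  assume eq: "thread_equiv \<Lambda> (r0 X) z z'"
  have "pt z \<in> wedge X l (z' l)" if l: "l \<in> \<Lambda>" for l
  proof -
    obtain m where m: "m \<in> \<Lambda>" "l \<subseteq> m"
      "\<And>a b c. pt z \<in> wedge X m a \<Longrightarrow> (a, b) \<in> r0 X m \<Longrightarrow> (b, c) \<in> r0 X m \<Longrightarrow> \<forall>\<alpha>\<in>l. pt z \<in> c \<alpha>"
      using star_control[OF l pt_topspace[OF z]] by blast
    have "(z m, z' m) \<in> r0 X m" using eq m(1) by (simp add: thread_equiv_def)
    moreover have "(z' m, z' m) \<in> r0 X m" using r0_refl F_N0[OF z' m(1)] by blast
    ultimately have "\<forall>\<alpha>\<in>l. pt z \<in> z' m \<alpha>" using m(3) pt_wedge[OF z m(1)] by blast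
    moreover have "z' m \<alpha> = z' l \<alpha>" if "\<alpha> \<in> l" for \<alpha>
      using F_component[OF z' l that] F_component[OF z' m(1)] that m(2) by (metis subsetD)
    ultimately show ?thesis using pt_topspace[OF z] by (auto simp: wedge_def)
  qed
  then show "pt z = pt z'" using pt_eqI[OF z', of "pt z"] by simp
qed

lemma star_setD:
  assumes "c \<in> star_set r (star_set r {a})"
  obtains b where "(a, b) \<in> r" "(b, c) \<in> r"
  using assms by (auto simp: star_set_def)

text \<open>One index from star control serves both axioms: its stars restrict to vertices whose
  sets contain the point of \<open>z\<close>. Such vertices are adjacent to \<open>z l\<close>, and
  there are finitely many because each cover has finitely many members through that point.\<close>

lemma cell: "cell_structure \<Lambda> (\<subseteq>) (N0 X) (r0 X) pi0"
  unfolding cell_structure_def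
proof (intro conjI ballI inverse_system)
  fix z l assume z: "z \<in> F" and l: "l \<in> \<Lambda>"
  let ?x = "pt z"
  obtain m where m: "m \<in> \<Lambda>" "l \<subseteq> m"
    "\<And>a b c. ?x \<in> wedge X m a \<Longrightarrow> (a, b) \<in> r0 X m \<Longrightarrow> (b, c) \<in> r0 X m \<Longrightarrow> \<forall>\<alpha>\<in>l. ?x \<in> c \<alpha>"
    using star_control[OF l pt_topspace[OF z]] by blast
  have star: "\<forall>\<alpha>\<in>l. ?x \<in> c \<alpha>" "c \<in> N0 X m" if c: "c \<in> star_set (r0 X m) (star_set (r0 X m) {z m})" for c
  proof -
    obtain b where b: "(z m, b) \<in> r0 X m" "(b, c) \<in> r0 X m" by (rule star_setD[OF c]) (rule that)
    show "\<forall>\<alpha>\<in>l. ?x \<in> c \<alpha>" using m(3)[OF pt_wedge[OF z m(1)] b] .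
    show "c \<in> N0 X m" using r0_N0[OF b(2)] by blast
  qed
  show "\<exists>m\<in>\<Lambda>. l \<subseteq> m \<and> pi0 m l ` star_set (r0 X m) (star_set (r0 X m) {z m}) \<subseteq> star_set (r0 X l) {z l}"
  proof (intro bexI[OF _ m(1)] conjI m(2) image_subsetI)
    fix c assume c: "c \<in> star_set (r0 X m) (star_set (r0 X m) {z m})"
    have "?x \<in> wedge X l (restrict c l)" using star(1)[OF c] pt_topspace[OF z] by (auto simp: wedge_def)
    then have "(z l, restrict c l) \<in> r0 X l"
      by (rule r0_common[OF F_N0[OF z l] restrict_N0[OF m(2) star(2)[OF c]] pt_wedge[OF z l]])
    then show "pi0 m l c \<in> star_set (r0 X l) {z l}" by (simp add: pi0_def star_set_def)
  qed
  show "\<exists>m\<in>\<Lambda>. l \<subseteq> m \<and> finite (pi0 m l ` star_set (r0 X m) {z m})"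
  proof (intro bexI[OF _ m(1)] conjI m(2))
    have "pi0 m l c \<in> PiE l (\<lambda>\<alpha>. {V\<in>\<alpha>. ?x \<in> V})" if "c \<in> star_set (r0 X m) {z m}" for c
    proof -
      have "z m \<in> star_set (r0 X m) {z m}" using r0_refl[OF F_N0[OF z m(1)]] by (simp add: star_set_def)
      then have "c \<in> star_set (r0 X m) (star_set (r0 X m) {z m})" using that by (auto simp: star_set_def)
      then show ?thesis using star[of c] N0_mem[of c m] m(2) by (auto simp: pi0_def)
    qed
    then have "pi0 m l ` star_set (r0 X m) {z m} \<subseteq> PiE l (\<lambda>\<alpha>. {V\<in>\<alpha>. ?x \<in> V})" by blast
    moreover have "finite (PiE l (\<lambda>\<alpha>. {V\<in>\<alpha>. ?x \<in> V}))"
      using finite_members[OF Lam_simps(2)[OF l] pt_topspace[OF z]] Lam_simps(1)[OF l] by (intro finite_PiE) auto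
    ultimately show "finite (pi0 m l ` star_set (r0 X m) {z m})" by (rule finite_subset)
  qed
qed

end

section \<open>Completeness and the homeomorphism\<close>

lemma openin_quotient_topology:
  "openin (quotient_topology T q) U \<longleftrightarrow> U \<subseteq> q ` topspace T \<and> openin T {x\<in>topspace T. q x \<in> U}"
proof -
  have "istopology (\<lambda>U. U \<subseteq> q ` topspace T \<and> openin T {x\<in>topspace T. q x \<in> U})"
    unfolding istopology_def
  proof (intro conjI allI impI)
    fix S S' assume "S \<subseteq> q ` topspace T \<and> openin T {x\<in>topspace T. q x \<in> S}"
      "S' \<subseteq> q ` topspace T \<and> openin T {x\<in>topspace T. q x \<in> S'}"
    then have "openin T ({x\<in>topspace T. q x \<in> S} \<inter> {x\<in>topspace T. q x \<in> S'})" "S \<inter> S' \<subseteq> q ` topspace T"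
      by (auto intro: openin_Int)
    moreover have "{x\<in>topspace T. q x \<in> S} \<inter> {x\<in>topspace T. q x \<in> S'} = {x\<in>topspace T. q x \<in> S \<inter> S'}"
      by blast
    ultimately show "S \<inter> S' \<subseteq> q ` topspace T" "openin T {x\<in>topspace T. q x \<in> S \<inter> S'}" by simp_all
  next
    fix K assume K: "\<forall>S\<in>K. S \<subseteq> q ` topspace T \<and> openin T {x\<in>topspace T. q x \<in> S}"
    then show "\<Union>K \<subseteq> q ` topspace T" by blast
    have "openin T (\<Union>S\<in>K. {x\<in>topspace T. q x \<in> S})" using K by blast
    moreover have "(\<Union>S\<in>K. {x\<in>topspace T. q x \<in> S}) = {x\<in>topspace T. q x \<in> \<Union>K}" by blast
    ultimately show "openin T {x\<in>topspace T. q x \<in> \<Union>K}" by simp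
  qed
  then show ?thesis by (simp add: quotient_topology_def)
qed

lemma topspace_quotient_topology: "topspace (quotient_topology T q) = q ` topspace T"
proof
  show "topspace (quotient_topology T q) \<subseteq> q ` topspace T"
    using openin_topspace[of "quotient_topology T q"] unfolding openin_quotient_topology by blast
  have "{x\<in>topspace T. q x \<in> q ` topspace T} = topspace T" by blast
  then have "openin (quotient_topology T q) (q ` topspace T)" by (simp add: openin_quotient_topology)
  then show "q ` topspace T \<subseteq> topspace (quotient_topology T q)" by (rule openin_subset)
qed

context complete_cofinal
begin

abbreviation T where "T \<equiv> limit_topology (Lam \<A>) (\<subseteq>) (N0 X) pi0"
abbreviation cls where "cls \<equiv> thread_class (Lam \<A>) (\<subseteq>) (N0 X) (r0 X) pi0"

lemma Lam_iff: "l \<in> \<Lambda> \<longleftrightarrow> finite l \<and> l \<subseteq> \<A>"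
  by (simp add: Lam_def)

text \<open>The limit thread is selected by compactness among the finitely many members through the limit
  point, so that each of its coordinates is attained arbitrarily far along the net.\<close>
lemma Cauchy_net_converges:
  assumes "cauchy_net \<Lambda> (\<subseteq>) (N0 X) (r0 X) pi0 y"
  shows "\<exists>z\<in>F. net_converges_to \<Lambda> (\<subseteq>) (r0 X) y z"
proof -
  have y: "y l \<in> N0 X l" if "l \<in> \<Lambda>" for l using assms that by (simp add: cauchy_net_def)
  have "\<exists>k\<in>\<Lambda>. \<forall>l0\<in>\<Lambda>. \<forall>l1\<in>\<Lambda>. \<forall>l2\<in>\<Lambda>. k \<subseteq> l1 \<and> l0 \<subseteq> l1 \<and> k \<subseteq> l2 \<and> l0 \<subseteq> l2 \<longrightarrow>
      (restrict (y l1) l0, restrict (y l2) l0) \<in> r0 X l0"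
    using assms by (simp add: cauchy_net_def pi0_def)
  then obtain k where k: "k \<in> \<Lambda>" and k_adj: "\<forall>l0\<in>\<Lambda>. \<forall>l1\<in>\<Lambda>. \<forall>l2\<in>\<Lambda>.
      k \<subseteq> l1 \<and> l0 \<subseteq> l1 \<and> k \<subseteq> l2 \<and> l0 \<subseteq> l2 \<longrightarrow> (restrict (y l1) l0, restrict (y l2) l0) \<in> r0 X l0" ..
  have kr: "(restrict (y l1) l0, restrict (y l2) l0) \<in> r0 X l0"
    if "l0 \<in> \<Lambda>" "l1 \<in> \<Lambda>" "l2 \<in> \<Lambda>" "k \<subseteq> l1" "l0 \<subseteq> l1" "k \<subseteq> l2" "l0 \<subseteq> l2" for l0 l1 l2
    using k_adj[rule_format, OF that(1-3)] that(4-7) by simp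
  \<comment> \<open>The wedges of a net, unlike those of a thread, need not decrease, so whole tails
    are taken.\<close>
  define B where "B l = (\<Union>l'\<in>{l'\<in>\<Lambda>. k \<union> l \<subseteq> l'}. wedge X l' (y l'))" for l
  have wB: "wedge X l' (y l') \<subseteq> B l" if "l' \<in> \<Lambda>" "k \<union> l \<subseteq> l'" for l l' using that by (auto simp: B_def)
  have "\<exists>l\<in>\<Lambda>. B l \<times> B l \<subseteq> U" if U: "U \<in> \<U>" for U
  proof -
    have "uniformity_on (topspace X) \<U>" using compat by (simp add: compatible_uniformity_def)
    then obtain V where V: "V \<in> \<U>" "V O V \<subseteq> U" using uniformity_on_half U by blast
    obtain \<alpha> where a: "\<alpha> \<in> \<A>" "\<forall>C\<in>\<alpha>. C \<times> C \<subseteq> V" using small_member[OF V(1)] by blast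
    have la: "{\<alpha>} \<in> \<Lambda>" using a(1) Lam_simps(4) by blast
    have "(p, q) \<in> U" if pq: "p \<in> B {\<alpha>}" "q \<in> B {\<alpha>}" for p q
    proof -
      obtain l1 where l1: "l1 \<in> \<Lambda>" "k \<subseteq> l1" "{\<alpha>} \<subseteq> l1" "p \<in> wedge X l1 (y l1)" using pq(1) by (auto simp: B_def)
      obtain l2 where l2: "l2 \<in> \<Lambda>" "k \<subseteq> l2" "{\<alpha>} \<subseteq> l2" "q \<in> wedge X l2 (y l2)" using pq(2) by (auto simp: B_def)
      \<comment> \<open>Points of two terms are compared through a point common to their members of
        \<open>\<alpha>\<close>; this is why \<open>\<alpha>\<close> is small for a half of
        \<open>U\<close>.\<close>
      have "restrict (y l1) {\<alpha>} \<alpha> \<inter> restrict (y l2) {\<alpha>} \<alpha> \<noteq> {}"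
        by (rule r0_meet[OF kr[OF la l1(1) l2(1) l1(2,3) l2(2,3)]]) auto
      then obtain s where s: "s \<in> y l1 \<alpha>" "s \<in> y l2 \<alpha>" by auto
      have "p \<in> y l1 \<alpha>" "q \<in> y l2 \<alpha>" using l1(3,4) l2(3,4) by (auto simp: wedge_def)
      moreover have "y l1 \<alpha> \<times> y l1 \<alpha> \<subseteq> V" "y l2 \<alpha> \<times> y l2 \<alpha> \<subseteq> V"
        using a(2) N0_mem[OF y[OF l1(1)]] N0_mem[OF y[OF l2(1)]] l1(3) l2(3) by blast+
      ultimately have "(p, s) \<in> V" "(s, q) \<in> V" using s by blast+
      then show ?thesis using V(2) by blast
    qed
    then show ?thesis using la by blast
  qed
  moreover have "B l \<noteq> {}" if "l \<in> \<Lambda>" for l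
    using wB[OF Lam_simps(5)[OF k that] order_refl] N0_wedge[OF y[OF Lam_simps(5)[OF k that]]] by blast
  moreover have "B l \<subseteq> topspace X" for l by (auto simp: B_def wedge_def)
  moreover have "B m \<subseteq> B l" if "l \<subseteq> m" for l m using that by (auto simp: B_def)
  ultimately obtain x where x: "x \<in> topspace X" "\<And>W. openin X W \<and> x \<in> W \<Longrightarrow> \<exists>l\<in>\<Lambda>. B l \<subseteq> W"
    using Cauchy_family_limit[of B] by blast
  have far: "\<exists>m\<in>\<Lambda>. k \<union> l \<subseteq> m \<and> (\<forall>\<alpha>\<in>l. x \<in> y m \<alpha>)" if l: "l \<in> \<Lambda>" for l
  proof -
    obtain W where W: "openin X W" "x \<in> W" "\<forall>\<alpha>\<in>l. \<forall>V\<in>\<alpha>. V \<inter> W \<noteq> {} \<longrightarrow> x \<in> V"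
      using neighbourhood[OF l x(1)] by blast
    obtain n where n: "n \<in> \<Lambda>" "B n \<subseteq> W" using x(2) W(1,2) by blast
    let ?m = "k \<union> l \<union> n"
    have m: "?m \<in> \<Lambda>" using k l n(1) Lam_simps(5) by blast
    have "wedge X ?m (y ?m) \<subseteq> W" using wB[OF m, of n] n(2) by blast
    moreover obtain p where "p \<in> wedge X ?m (y ?m)" using N0_wedge[OF y[OF m]] by blast
    ultimately have p: "p \<in> W" "\<And>\<alpha>. \<alpha> \<in> l \<Longrightarrow> p \<in> y ?m \<alpha>" by (auto simp: wedge_def)
    have "x \<in> y ?m \<alpha>" if "\<alpha> \<in> l" for \<alpha>
    proof -
      have "y ?m \<alpha> \<in> \<alpha>" using N0_mem[OF y[OF m]] that by blast
      moreover have "y ?m \<alpha> \<inter> W \<noteq> {}" using p that by blast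
      ultimately show ?thesis using W(3) that by blast
    qed
    then show ?thesis using m by blast
  qed
  \<comment> \<open>On \<open>l\<close> the choice copies a later term of the net, which the Cauchy
    condition makes comparable with \<open>y l\<close>.\<close>
  define P where "P l w \<longleftrightarrow> (\<exists>m\<in>\<Lambda>. k \<union> l \<subseteq> m \<and> (\<forall>\<alpha>\<in>l. w \<alpha> = y m \<alpha>))" for l w
  have "\<exists>w\<in>PiE \<A> (\<lambda>\<alpha>. {V\<in>\<alpha>. x \<in> V}). \<forall>l. finite l \<and> l \<subseteq> \<A> \<longrightarrow> P l w"
  proof (rule finite_choice_compactness)
    show "finite {V\<in>\<alpha>. x \<in> V}" if "\<alpha> \<in> \<A>" for \<alpha> using finite_members[OF that x(1)] .
    show "P l w'" if "\<forall>i\<in>l. w' i = w i" "P l w" for l w w' using that by (simp add: P_def)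
    show "P l w" if lm: "l \<subseteq> m" and Pm: "P m w" for l m w
    proof -
      obtain n where "n \<in> \<Lambda>" "k \<union> m \<subseteq> n" "\<forall>\<alpha>\<in>m. w \<alpha> = y n \<alpha>"
        using Pm unfolding P_def by (elim bexE conjE) (rule that)
      then show ?thesis unfolding P_def using lm by (intro bexI[of _ n]) auto
    qed
    fix l assume "finite l" "l \<subseteq> \<A>"
    then have l: "l \<in> \<Lambda>" by (simp add: Lam_iff)
    obtain m where m: "m \<in> \<Lambda>" "k \<union> l \<subseteq> m" "\<forall>\<alpha>\<in>l. x \<in> y m \<alpha>" using far[OF l] by blast
    obtain v where v: "\<And>\<alpha>. \<alpha> \<in> \<A> \<Longrightarrow> v \<alpha> \<in> \<alpha> \<and> x \<in> v \<alpha>" by (rule choice_exists[OF x(1)]) (rule that)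
    \<comment> \<open>Off \<open>l\<close> any member through \<open>x\<close> will do; it only
      keeps the choice inside the compact product.\<close>
    let ?w = "\<lambda>\<alpha>\<in>\<A>. if \<alpha> \<in> l then y m \<alpha> else v \<alpha>"
    have "?w \<in> PiE \<A> (\<lambda>\<alpha>. {V\<in>\<alpha>. x \<in> V})"
      using v m(2,3) N0_mem[OF y[OF m(1)]] by auto
    moreover have "P l ?w" unfolding P_def using m Lam_simps(2)[OF l] by (intro bexI[of _ m]) auto
    ultimately show "\<exists>w\<in>PiE \<A> (\<lambda>\<alpha>. {V\<in>\<alpha>. x \<in> V}). P l w" by blast
  qed
  then obtain w where w: "w \<in> PiE \<A> (\<lambda>\<alpha>. {V\<in>\<alpha>. x \<in> V})" "\<And>l. l \<in> \<Lambda> \<Longrightarrow> P l w"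
    by (auto simp: Lam_iff)
  have "thread w \<in> F" by (rule thread_in(1)[OF x(1)]) (use w(1) in auto)
  moreover have "(y l, thread w l) \<in> r0 X l" if l: "l \<in> \<Lambda>" "k \<subseteq> l" for l
  proof -
    obtain m where m: "m \<in> \<Lambda>" "k \<union> l \<subseteq> m" "\<forall>\<alpha>\<in>l. w \<alpha> = y m \<alpha>" using w(2)[OF l(1)] by (auto simp: P_def)
    \<comment> \<open>The Cauchy condition with base index \<open>l\<close> compares
      \<open>y l\<close> with the later term that the thread copies there.\<close>
    have "(restrict (y l) l, restrict (y m) l) \<in> r0 X l" by (rule kr) (use l m in auto)
    moreover have "restrict (y l) l = y l" using y[OF l(1)] by (auto simp: N0_def PiE_restrict)
    moreover have "restrict (y m) l = thread w l" unfolding thread_apply[OF l(1)] using m(3) by (intro restrict_ext) simp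
    ultimately show ?thesis by simp
  qed
  ultimately show ?thesis using k unfolding net_converges_to_def by blast
qed

lemma topspace_T: "topspace T = F"
  unfolding limit_topology_def by (auto simp: inv_limit_def)

text \<open>Finitely many coordinate conditions reduce to one, at the union of their indices,
  because a coordinate of a thread determines all coordinates at smaller indices.\<close>

lemma openin_T:
  "openin T O' \<longleftrightarrow> O' \<subseteq> F \<and> (\<forall>z\<in>O'. \<exists>l\<in>\<Lambda>. \<forall>z'\<in>F. z' l = z l \<longrightarrow> z' \<in> O')"
proof
  let ?P = "product_topology (\<lambda>l. discrete_topology (N0 X l)) \<Lambda>"
  assume "openin T O'"
  then obtain S where S: "openin ?P S" "O' = S \<inter> F"
    unfolding limit_topology_def openin_subtopology by blast
  show "O' \<subseteq> F \<and> (\<forall>z\<in>O'. \<exists>l\<in>\<Lambda>. \<forall>z'\<in>F. z' l = z l \<longrightarrow> z' \<in> O')"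
  proof (intro conjI ballI)
    show "O' \<subseteq> F" using S(2) by blast
    fix z assume z: "z \<in> O'"
    then have "z \<in> S" using S(2) by blast
    then have "\<exists>U. finite {l\<in>\<Lambda>. U l \<noteq> N0 X l} \<and> (\<forall>l\<in>\<Lambda>. openin (discrete_topology (N0 X l)) (U l)) \<and>
        z \<in> PiE \<Lambda> U \<and> PiE \<Lambda> U \<subseteq> S"
      using S(1) unfolding openin_product_topology_alt topspace_discrete_topology by (elim bspec[rotated])
    then obtain U where U: "finite {l\<in>\<Lambda>. U l \<noteq> N0 X l}" "z \<in> PiE \<Lambda> U" "PiE \<Lambda> U \<subseteq> S"
      by (elim exE conjE) (rule that)
    let ?l = "\<Union>{l\<in>\<Lambda>. U l \<noteq> N0 X l}"
    have l: "?l \<in> \<Lambda>" using U(1) by (auto simp: Lam_iff)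
    have "z' \<in> O'" if z': "z' \<in> F" "z' ?l = z ?l" for z'
    proof -
      have "z' i \<in> U i" if i: "i \<in> \<Lambda>" for i
      proof (cases "U i = N0 X i")
        case True
        then show ?thesis using F_N0[OF z'(1) i] by simp
      next
        case False
        then have il: "i \<subseteq> ?l" using i by blast
        have "z' i = z i"
          using F_restrict[OF z'(1) i l il] F_restrict[OF _ i l il, of z] z'(2) z S(2) by auto
        then show ?thesis using U(2) i by auto
      qed
      then have "z' \<in> PiE \<Lambda> U" using z'(1) by (auto simp: inv_limit_def PiE_iff)
      then show ?thesis using U(3) S(2) z'(1) by blast
    qed
    then show "\<exists>l\<in>\<Lambda>. \<forall>z'\<in>F. z' l = z l \<longrightarrow> z' \<in> O'" using l by blast
  qed
next
  let ?P = "product_topology (\<lambda>l. discrete_topology (N0 X l)) \<Lambda>"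
  assume O': "O' \<subseteq> F \<and> (\<forall>z\<in>O'. \<exists>l\<in>\<Lambda>. \<forall>z'\<in>F. z' l = z l \<longrightarrow> z' \<in> O')"
  show "openin T O'"
  proof (subst openin_subopen, intro ballI)
    fix z assume z: "z \<in> O'"
    then obtain l where l: "l \<in> \<Lambda>" "\<forall>z'\<in>F. z' l = z l \<longrightarrow> z' \<in> O'" using O' by blast
    have zF: "z \<in> F" using z O' by blast
    have "openin ?P {z'\<in>PiE \<Lambda> (N0 X). \<forall>i\<in>{l}. z' i = z i}"
      by (rule openin_product_discrete_cylinder) (use l zF in \<open>auto simp: inv_limit_def\<close>)
    then have "openin T ({z'\<in>PiE \<Lambda> (N0 X). \<forall>i\<in>{l}. z' i = z i} \<inter> F)"
      unfolding limit_topology_def by (rule openin_subtopology_Int)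
    moreover have "z \<in> {z'\<in>PiE \<Lambda> (N0 X). \<forall>i\<in>{l}. z' i = z i} \<inter> F" using zF by (auto simp: inv_limit_def)
    moreover have "{z'\<in>PiE \<Lambda> (N0 X). \<forall>i\<in>{l}. z' i = z i} \<inter> F \<subseteq> O'" using l(2) by auto
    ultimately show "\<exists>S. openin T S \<and> z \<in> S \<and> S \<subseteq> O'" by blast
  qed
qed

section \<open>The projection to \<open>X\<close> as a quotient map\<close>

text \<open>The set of \<open>z\<close> at \<open>\<beta>2\<close> lies in \<open>U\<close>, so
  every thread sharing this one coordinate has its point in \<open>U\<close>.\<close>

lemma openin_pt_preimage:
  assumes U: "openin X U"
  shows "openin T {z\<in>F. pt z \<in> U}"
  unfolding openin_T
proof (intro conjI ballI)
  fix z assume "z \<in> {z\<in>F. pt z \<in> U}"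
  then have z: "z \<in> F" "pt z \<in> U" by auto
  obtain \<beta>1 \<beta>2 where b: "\<beta>1 \<in> \<A>" "\<beta>2 \<in> \<A>"
    "\<And>V V'. V \<in> \<beta>1 \<Longrightarrow> V' \<in> \<beta>2 \<Longrightarrow> pt z \<in> V \<Longrightarrow> V \<inter> V' \<noteq> {} \<Longrightarrow> V' \<subseteq> U"
    using two_step_separation[OF U z(2)] by metis
  have l: "{\<beta>1} \<in> \<Lambda>" "{\<beta>2} \<in> \<Lambda>" using b Lam_simps(4) by blast+
  have "pt z \<in> z {\<beta>1} \<beta>1" "pt z \<in> z {\<beta>2} \<beta>2" using pt_component[OF z(1)] l by blast+
  moreover have "z {\<beta>1} \<beta>1 \<in> \<beta>1" "z {\<beta>2} \<beta>2 \<in> \<beta>2" using N0_mem[OF F_N0[OF z(1)]] l by blast+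
  ultimately have sub: "z {\<beta>2} \<beta>2 \<subseteq> U" using b(3) by blast
  have "pt z' \<in> U" if "z' \<in> F" "z' {\<beta>2} = z {\<beta>2}" for z'
    using pt_component[OF that(1) l(2), of \<beta>2] that(2) sub by auto
  then show "\<exists>l\<in>\<Lambda>. \<forall>z'\<in>F. z' l = z l \<longrightarrow> z' \<in> {z\<in>F. pt z \<in> U}" using l(2) by blast
qed blast

text \<open>Compactness of the choices over \<open>x\<close> yields one index \<open>l\<close> such
  that every thread whose sets at \<open>l\<close> all contain \<open>x\<close> has its point in
  \<open>U\<close>. Over points near \<open>x\<close> all threads have this property at
  \<open>l\<close>.\<close>

lemma openin_of_pt_preimage:
  assumes UX: "U \<subseteq> topspace X" and op: "openin T {z\<in>F. pt z \<in> U}"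
  shows "openin X U"
proof (subst openin_subopen, intro ballI)
  fix x assume xU: "x \<in> U"
  then have x: "x \<in> topspace X" using UX by blast
  \<comment> \<open>A choice satisfying this at every \<open>l\<close> would be a thread over
    \<open>x\<close> in the closure of the threads whose points avoid \<open>U\<close>, against
    openness of the preimage.\<close>
  define P where "P l w \<longleftrightarrow> (\<exists>z\<in>F. pt z \<notin> U \<and> (\<forall>\<alpha>\<in>l. z l \<alpha> = w \<alpha>))" for l w
  let ?K = "\<lambda>\<alpha>. {V\<in>\<alpha>. x \<in> V}"
  have "\<exists>l\<in>\<Lambda>. \<forall>w\<in>PiE \<A> ?K. \<not> P l w"
  proof (rule ccontr)
    assume neg: "\<not> (\<exists>l\<in>\<Lambda>. \<forall>w\<in>PiE \<A> ?K. \<not> P l w)"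
    have "\<exists>w\<in>PiE \<A> ?K. \<forall>l. finite l \<and> l \<subseteq> \<A> \<longrightarrow> P l w"
    proof (rule finite_choice_compactness)
      show "finite (?K \<alpha>)" if "\<alpha> \<in> \<A>" for \<alpha> using finite_members[OF that x] .
      show "P l w'" if "\<forall>i\<in>l. w' i = w i" "P l w" for l w w' using that by (simp add: P_def)
      show "P l w" if m: "finite m" "m \<subseteq> \<A>" "l \<subseteq> m" "P m w" for l m w
      proof -
        have lm: "m \<in> \<Lambda>" "l \<in> \<Lambda>" using m finite_subset by (auto simp: Lam_iff)
        obtain z where z: "z \<in> F" "pt z \<notin> U" "\<forall>\<alpha>\<in>m. z m \<alpha> = w \<alpha>" using m(4) by (auto simp: P_def)
        have "z l \<alpha> = w \<alpha>" if "\<alpha> \<in> l" for \<alpha>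
          using F_component[OF z(1) lm(2) that] F_component[OF z(1) lm(1), of \<alpha>] z(3) that m(3)
          by (metis subsetD)
        then show ?thesis using z(1,2) unfolding P_def by blast
      qed
      show "\<exists>w\<in>PiE \<A> ?K. P l w" if "finite l" "l \<subseteq> \<A>" for l using neg that by (auto simp: Lam_iff)
    qed
    then obtain w where w: "w \<in> PiE \<A> ?K" "\<And>l. l \<in> \<Lambda> \<Longrightarrow> P l w" by (auto simp: Lam_iff)
    have t: "thread w \<in> F" "pt (thread w) = x" by (rule thread_in[OF x]; use w(1) in auto)+
    then obtain l where l: "l \<in> \<Lambda>" "\<forall>z'\<in>F. z' l = thread w l \<longrightarrow> z' \<in> {z\<in>F. pt z \<in> U}"
      using op xU unfolding openin_T by blast
    obtain z where z: "z \<in> F" "pt z \<notin> U" "\<forall>\<alpha>\<in>l. z l \<alpha> = w \<alpha>" using w(2)[OF l(1)] by (auto simp: P_def)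
    have "z l = restrict (z l) l" using F_restrict[OF z(1) l(1) l(1)] by simp
    also have "\<dots> = thread w l" unfolding thread_apply[OF l(1)] using z(3) by (intro restrict_ext) simp
    finally show False using l(2) z(1,2) by blast
  qed
  then obtain l where l: "l \<in> \<Lambda>" "\<And>w. w \<in> PiE \<A> ?K \<Longrightarrow> \<not> P l w" by blast
  obtain W where W: "openin X W" "x \<in> W" "\<forall>\<alpha>\<in>l. \<forall>V\<in>\<alpha>. V \<inter> W \<noteq> {} \<longrightarrow> x \<in> V"
    using neighbourhood[OF l(1) x] by blast
  have "W \<subseteq> U"
  proof
    fix p assume p: "p \<in> W"
    then have "p \<in> topspace X" using W(1) openin_subset by blast
    then obtain z where z: "z \<in> F" "pt z = p" using pt_surj by blast
    obtain v where v: "\<And>\<alpha>. \<alpha> \<in> \<A> \<Longrightarrow> v \<alpha> \<in> \<alpha> \<and> x \<in> v \<alpha>" by (rule choice_exists[OF x]) (rule that)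
    \<comment> \<open>The sets of \<open>z\<close> at \<open>l\<close> meet \<open>W\<close>, hence
      contain \<open>x\<close>, so this part of a thread over \<open>p\<close> extends to a choice
      over \<open>x\<close>.\<close>
    let ?w = "\<lambda>\<alpha>\<in>\<A>. if \<alpha> \<in> l then z l \<alpha> else v \<alpha>"
    have "z l \<alpha> \<in> ?K \<alpha>" if "\<alpha> \<in> l" for \<alpha>
    proof -
      have "z l \<alpha> \<in> \<alpha>" using N0_mem[OF F_N0[OF z(1) l(1)] that] .
      moreover have "z l \<alpha> \<inter> W \<noteq> {}" using pt_component[OF z(1) l(1) that] z(2) p by blast
      ultimately show ?thesis using W(3) that by blast
    qed
    then have "?w \<in> PiE \<A> ?K" using v by auto
    then have "\<not> P l ?w" by (rule l(2))
    moreover have "\<forall>\<alpha>\<in>l. z l \<alpha> = ?w \<alpha>" using Lam_simps(2)[OF l(1)] by simp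
    ultimately show "p \<in> U" using z unfolding P_def by blast
  qed
  then show "\<exists>S. openin X S \<and> x \<in> S \<and> S \<subseteq> U" using W by blast
qed

lemma cls_eq: "z \<in> F \<Longrightarrow> cls z = {z'\<in>F. pt z' = pt z}"
  using equiv_iff_pt_eq by (auto simp: thread_class_def)

text \<open>Equivalence classes are the fibres of \<open>pt\<close>, so \<open>x\<close> goes to its
  fibre; the two preimage lemmas then match the open sets on both sides.\<close>

lemma homeomorphism:
  "homeomorphic_map X (quotient_of_limit \<Lambda> (\<subseteq>) (N0 X) (r0 X) pi0) (\<lambda>x. {z\<in>F. pt z = x})"
  (is "homeomorphic_map X ?Q ?h")
proof -
  have hq: "?h (pt z) = cls z" if "z \<in> F" for z using cls_eq[OF that] by simp
  have top: "topspace ?Q = cls ` F"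
    by (simp add: quotient_of_limit_def topspace_quotient_topology topspace_T)
  have "?h ` topspace X = topspace ?Q"
  proof
    show "?h ` topspace X \<subseteq> topspace ?Q" unfolding top using pt_surj hq by blast
    show "topspace ?Q \<subseteq> ?h ` topspace X" unfolding top
    proof
      fix c assume "c \<in> cls ` F"
      then obtain z where "z \<in> F" "c = cls z" by blast
      then show "c \<in> ?h ` topspace X" using hq[of z] pt_topspace[of z] by blast
    qed
  qed
  moreover have "openin X {x\<in>topspace X. ?h x \<in> S} \<longleftrightarrow> openin ?Q S" if S: "S \<subseteq> topspace ?Q" for S
  proof -
    let ?U = "{x\<in>topspace X. ?h x \<in> S}"
    have eq: "{z\<in>F. pt z \<in> ?U} = {z\<in>F. cls z \<in> S}" using hq pt_topspace by auto
    have "openin X ?U \<longleftrightarrow> openin T {z\<in>F. pt z \<in> ?U}"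
      using openin_pt_preimage[of ?U] openin_of_pt_preimage[of ?U] by blast
    also have "\<dots> \<longleftrightarrow> openin ?Q S"
      unfolding eq using S by (simp add: quotient_of_limit_def openin_quotient_topology topspace_T topspace_quotient_topology)
    finally show ?thesis .
  qed
  moreover have "inj_on ?h (topspace X)"
  proof (rule inj_onI)
    fix x x' assume xx: "x \<in> topspace X" "?h x = ?h x'"
    obtain z where "z \<in> F" "pt z = x" using pt_surj[OF xx(1)] by blast
    then have "z \<in> ?h x'" using xx(2) by blast
    then show "x = x'" using \<open>pt z = x\<close> by simp
  qed
  ultimately show ?thesis unfolding homeomorphic_map_def quotient_map_def by blast
qed

end

theorem theorem3p1:
  fixes X :: "'a topology" and \<A> :: "'a set set set"
  assumes "topologically_complete X"
    and "cofinal_clfn X \<A>"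
  shows "complete_cell_structure (Lam \<A>) (\<subseteq>) (N0 X) (r0 X) pi0
    \<and> (\<exists>h. homeomorphic_map X (quotient_of_limit (Lam \<A>) (\<subseteq>) (N0 X) (r0 X) pi0) h
           \<and> (\<forall>z\<in>inv_limit (Lam \<A>) (\<subseteq>) (N0 X) pi0.
                 h (pi_point X \<A> z) = thread_class (Lam \<A>) (\<subseteq>) (N0 X) (r0 X) pi0 z)
           \<and> (\<forall>h'. homeomorphic_map X (quotient_of_limit (Lam \<A>) (\<subseteq>) (N0 X) (r0 X) pi0) h'
                  \<and> (\<forall>z\<in>inv_limit (Lam \<A>) (\<subseteq>) (N0 X) pi0.
                        h' (pi_point X \<A> z) = thread_class (Lam \<A>) (\<subseteq>) (N0 X) (r0 X) pi0 z)
                  \<longrightarrow> (\<forall>x\<in>topspace X. h' x = h x)))"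
proof -
  obtain \<U> where "compatible_uniformity X \<U>" "complete_wrt X \<U>" "tychonoff_space X"
    using assms(1) unfolding topologically_complete_def finest_uniformity_def by blast
  then interpret complete_cofinal X \<A> \<U>
    using assms(2) by unfold_locales
  let ?h = "\<lambda>x. {z\<in>F. pt z = x}"
  have unique: "\<forall>x\<in>topspace X. h' x = {z\<in>F. pt z = x}" if h': "\<forall>z\<in>F. h' (pt z) = cls z" for h'
  proof
    fix x assume "x \<in> topspace X"
    then obtain z where "z \<in> F" "pt z = x" using pt_surj by blast
    then show "h' x = {z\<in>F. pt z = x}" using h' cls_eq by auto
  qed
  show ?thesis
  proof (intro conjI exI[of _ ?h] allI impI)
    show "complete_cell_structure \<Lambda> (\<subseteq>) (N0 X) (r0 X) pi0"
      unfolding complete_cell_structure_def using cell Cauchy_net_converges by blast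
    show "homeomorphic_map X (quotient_of_limit \<Lambda> (\<subseteq>) (N0 X) (r0 X) pi0) ?h"
      by (rule homeomorphism)
    show "\<forall>z\<in>F. ?h (pt z) = cls z" by (intro ballI) (simp only: cls_eq)
  qed (elim conjE, rule unique)
qed

end
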